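(* For $\lambda>0$ let $P_\lambda$ denote a Poisson random variable with parameter $\lambda$. For each $n\in\mathbb{N}$ let $(M_1(\alpha,z,n),\ldots,M_n(\alpha,z,n))$ be distributed as the negative Binomial compound Poisson sampling model (NB-CPSM) with parameters $(\alpha,z)$ and sample size $n$, and let $K(\alpha,z,n)=\sum_{r=1}^n M_r(\alpha,z,n)$. Then, as $n\rightarrow+\infty$: (i) if $\alpha\in(0,1)$ and $z>0$, then $$K(\alpha,z,n)\stackrel{w}{\longrightarrow}1+P_z$$ and, for every fixed $r\in\mathbb{N}$, $$M_r(\alpha,z,n)\stackrel{w}{\longrightarrow}P_{\frac{\alpha(1-\alpha)_{(r-1)}}{r!}z};$$ (ii) if $\alpha<0$ and $z<0$, then $$\frac{K(\alpha,z,n)}{n^{\frac{-\alpha}{1-\alpha}}}\stackrel{w}{\longrightarrow}\frac{(\alpha z)^{\frac{1}{1-\alpha}}}{-\alpha}$$ and, for every fixed $r\in\mathbb{N}$, $$M_r(\alpha,z,n)\stackrel{w}{\longrightarrow}P_{\frac{\alpha(1-\alpha)_{(r-1)}}{r!}z}.$$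
   Context: Notation: $\mathbb{N}=\{1,2,\ldots\}$; $(x)_{(n)}=\prod_{0\le i\le n-1}(x+i)$ is the ascending factorial, with $(x)_{(0)}=1$; $\stackrel{w}{\longrightarrow}$ denotes weak convergence (convergence in distribution) of random variables, where a constant limit is regarded as a degenerate random variable. Generalized factorial coefficients: $\mathscr{C}(n,j;\alpha)=\frac{1}{j!}\sum_{i=0}^{j}\binom{j}{i}(-1)^i(-i\alpha)_{(n)}$, with $\mathscr{C}(0,0;\alpha)=1$, $\mathscr{C}(n,0;\alpha)=0$ for $n\in\mathbb{N}$, and $\mathscr{C}(n,j;\alpha)=0$ for $j>n$. NB-CPSM: let either $\alpha\in(0,1)$ and $z>0$, or $\alpha<0$ and $z<0$. For $n\in\mathbb{N}$, the NB-CPSM with parameters $(\alpha,z)$ and sample size $n$ is the law of the random vector $(M_1(\alpha,z,n),\ldots,M_n(\alpha,z,n))$ with $$\Pr[(M_1(\alpha,z,n),\ldots,M_n(\alpha,z,n))=(x_1,\ldots,x_n)]=\frac{n!}{\sum_{j=0}^n\mathscr{C}(n,j;\alpha)z^j}\prod_{i=1}^n\frac{\left[z\frac{\alpha(1-\alpha)_{(i-1)}}{i!}\right]^{x_i}}{x_i!}$$ for non-negative integers $x_1,\ldots,x_n$ with $\sum_{i=1}^n i\,x_i=n$ (and probability zero otherwise). Equivalently, for any $q\in(0,1)$, it is the conditional law given $S=n$ of $(M_1,\ldots,M_S)$, where $M_r=\sum_{i=1}^K\mathbf{1}_{\{N_i=r\}}$, $S=\sum_{i=1}^K N_i$, $K$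 is Poisson with parameter $z[1-(1-q)^\alpha]$, and the $N_i$ are i.i.d., independent of $K$, with $\Pr[N_1=x]=-\frac{1}{1-(1-q)^\alpha}\binom{\alpha}{x}(-q)^x$, $x\in\mathbb{N}$. *)

theory Defs
  imports "HOL-Probability.Probability"
begin

text \<open>
  The library's \<^term>\<open>pochhammer\<close> is the ascending factorial.
\<close>

definition gen_fact_coeff :: "nat \<Rightarrow> nat \<Rightarrow> real \<Rightarrow> real" where
  "gen_fact_coeff n j \<alpha> =
     (1 / fact j) * (\<Sum>i\<le>j. real (j choose i) * (-1) ^ i * pochhammer (- real i * \<alpha>) n)"

lemma gen_fact_coeff_0_0: "gen_fact_coeff 0 0 \<alpha> = 1"
  by (simp add: gen_fact_coeff_def)

lemma gen_fact_coeff_0_right: "n \<ge> 1 \<Longrightarrow> gen_fact_coeff n 0 \<alpha> = 0"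
  by (simp add: gen_fact_coeff_def pochhammer_0_left)

text \<open>
  A vector \<open>(x\<^sub>1, \<dots>, x\<^sub>n)\<close> is represented by a function on \<^typ>\<open>nat\<close> of which only the
  values at \<open>1, \<dots>, n\<close> are used.
\<close>

definition nb_cpsm_prob :: "real \<Rightarrow> real \<Rightarrow> nat \<Rightarrow> (nat \<Rightarrow> nat) \<Rightarrow> real" where
  "nb_cpsm_prob \<alpha> z n x =
     (if (\<Sum>i=1..n. i * x i) = n
      then fact n / (\<Sum>j\<le>n. gen_fact_coeff n j \<alpha> * z ^ j) *
           (\<Prod>i=1..n. (z * (\<alpha> * pochhammer (1 - \<alpha>) (i - 1) / fact i)) ^ x i / fact (x i))
      else 0)"

text \<open>
  \<open>nb_cpsm \<alpha> z n \<Omega> M\<close>: the random vector \<open>(M\<^sub>1, \<dots>, M\<^sub>n)\<close> on the probability space \<open>\<Omega>\<close>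
  follows the negative Binomial compound Poisson sampling model with parameters
  \<open>(\<alpha>, z)\<close> and sample size \<open>n\<close>.
\<close>

definition nb_cpsm :: "real \<Rightarrow> real \<Rightarrow> nat \<Rightarrow> 'a measure \<Rightarrow> (nat \<Rightarrow> 'a \<Rightarrow> nat) \<Rightarrow> bool" where
  "nb_cpsm \<alpha> z n \<Omega> M \<longleftrightarrow>
     prob_space \<Omega> \<and>
     (\<forall>i\<in>{1..n}. M i \<in> measurable \<Omega> (count_space UNIV)) \<and>
     (\<forall>x. measure \<Omega> {\<omega> \<in> space \<Omega>. \<forall>i\<in>{1..n}. M i \<omega> = x i} = nb_cpsm_prob \<alpha> z n x)"

end

theory Submission
  imports Defs "HOL-Real_Asymp.Real_Asymp"
begin

text \<open>
The model is a Gibbs law on partitions: a vector \<open>x\<close> with \<open>\<Sum>i. i * x i = n\<close> has probability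
proportional to \<open>\<Prod>i. w i ^ x i / fact (x i)\<close>, where \<open>w i = z \<alpha> (1 - \<alpha>)_(i - 1) / i!\<close>. Put
\<open>W = \<Sum>i. w i X^i = z (1 - (1 - X)^\<alpha>)\<close> and let \<open>c n\<close> be the coefficient of \<open>X^n\<close> in \<open>exp W\<close>. By the
multinomial theorem the weights of the vectors with \<open>k\<close> blocks add up to the coefficient of \<open>X^n\<close> in
\<open>W^k / k!\<close>. Hence the normalising sum is \<open>c n\<close>, the law of the number of blocks is explicit
(\<open>gibbs_law_blocks\<close>), and the \<open>j\<close>-th binomial moment of the number of blocks of size \<open>r\<close> is
\<open>w r ^ j / j! * c (n - r * j) / c n\<close> (\<open>sum_gibbs_weight_binomial\<close>).

If \<open>c n / c (n + 1)\<close> tends to 1, these moments tend to the binomial moments of the Poisson law with mean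
\<open>w r\<close>, and inclusion-exclusion with dominated convergence gives the Poisson limit
(\<open>gibbs_multiplicity_weak_limit\<close>). It remains, for either sign of \<open>\<alpha>\<close>, to prove this ratio limit and to
find the behaviour of the number of blocks.

Let \<open>0 < \<alpha> < 1\<close>. The coefficients \<open>f n\<close> of \<open>1 - (1 - X)^\<alpha>\<close> are heavy-tailed: those of its \<open>k\<close>-th power
are asymptotic to \<open>k * f n\<close> and bounded by \<open>B^k * f n\<close>. Summation over \<open>k\<close> gives
\<open>c n \<sim> z exp z f n\<close> (\<open>gibbs_sum_cpsm_asymp\<close>), and the probability of \<open>k\<close> blocks tends to
\<open>z^(k - 1) exp (- z) / (k - 1)!\<close>. One block contains almost everything, and the others are Poisson in
number.

Let \<open>\<alpha> = - a < 0\<close> and \<open>z = - y < 0\<close>. Expanding \<open>exp (y (1 - X)^(- a))\<close> gives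
\<open>n! exp y c n = \<Sum>k. t k\<close> with the nonnegative terms \<open>t k = y^k / k! (k a)_n\<close> (\<open>dobinski_term_sums\<close>). Replacing
\<open>n\<close> by \<open>n + 1\<close> multiplies \<open>t k\<close> by \<open>k a + n\<close>; since the mean index is \<open>o(n)\<close>, the ratio limit
follows (\<open>gibbs_sum_cpsm_ratio_tendsto_1_neg\<close>). The quotient \<open>t (k + 1) / t k\<close> decreases in \<open>k\<close>, and at
\<open>k = s n^(a / (1 + a))\<close> it tends to \<open>(\<kappa> / s)^(1 + a)\<close> with \<open>\<kappa> = (a y)^(1 / (1 + a)) / a\<close>. Away from
\<open>\<kappa> n^(a / (1 + a))\<close> the terms therefore decay geometrically. The probability of \<open>k\<close> blocks is at most
\<open>exp y\<close> times the share of \<open>t k\<close> in the series (\<open>gibbs_law_blocks_le_dobinski\<close>), so the number of blocks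
concentrates at the same place (\<open>block_upper_tail\<close>, \<open>block_lower_tail\<close>).
\<close>

unbundle no vec_syntax and fps_syntax

section \<open>Gibbs weights on partitions\<close>

text \<open>
  The vectors of multiplicities of the partitions of \<open>n\<close> into parts of size at most \<open>m\<close>. The
  cut-off \<open>m\<close> is what inductions run over; the value 0 outside \<open>{1..m}\<close> makes every partition
  correspond to exactly one function.
\<close>

definition part_types :: "nat \<Rightarrow> nat \<Rightarrow> (nat \<Rightarrow> nat) set" where
  "part_types m n = {x. (\<forall>i. i \<notin> {1..m} \<longrightarrow> x i = 0) \<and> (\<Sum>i=1..m. i * x i) = n}"

definition gibbs_weight :: "(nat \<Rightarrow> real) \<Rightarrow> nat \<Rightarrow> (nat \<Rightarrow> nat) \<Rightarrow> real" where
  "gibbs_weight w m x = (\<Prod>i=1..m. w i ^ x i / fact (x i))"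

text \<open>
  The normalising sum. It is the coefficient of \<open>X^n\<close> in \<open>exp (\<Sum>i. w i X^i)\<close>.
\<close>

definition gibbs_sum :: "(nat \<Rightarrow> real) \<Rightarrow> nat \<Rightarrow> real" where
  "gibbs_sum w n = (\<Sum>x\<in>part_types n n. gibbs_weight w n x)"

definition weight_fps :: "(nat \<Rightarrow> real) \<Rightarrow> real fps" where
  "weight_fps w = Abs_fps (\<lambda>i. if i = 0 then 0 else w i)"

lemma part_types_part_le:
  assumes "x \<in> part_types m n"
  shows "i * x i \<le> n"
proof (cases "i \<in> {1..m}")
  case True
  then have "i * x i \<le> (\<Sum>i=1..m. i * x i)"
    by (intro member_le_sum[where f = "\<lambda>i. i * x i"]) auto
  then show ?thesis using assms by (simp add: part_types_def)
next
  case False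
  then show ?thesis using assms by (auto simp: part_types_def)
qed

lemma part_types_le:
  assumes "x \<in> part_types m n"
  shows "x i \<le> n"
proof (cases "i = 0")
  case True
  then show ?thesis using assms by (simp add: part_types_def)
next
  case False
  then have "x i \<le> i * x i" by simp
  then show ?thesis using part_types_part_le[OF assms, of i] by linarith
qed

lemma finite_part_types [simp]: "finite (part_types m n)"
proof (rule finite_subset)
  show "part_types m n \<subseteq> {x. \<forall>i. (i \<in> {1..m} \<longrightarrow> x i \<in> {..n}) \<and> (i \<notin> {1..m} \<longrightarrow> x i = 0)}"
    using part_types_le by (auto simp: part_types_def)
  show "finite {x. \<forall>i. (i \<in> {1..m} \<longrightarrow> x i \<in> {..n}) \<and> (i \<notin> {1..m} \<longrightarrow> x i = 0)}"
    by (rule finite_set_of_finite_funs) auto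
qed

lemma part_types_eq:
  assumes "n \<le> m"
  shows "part_types m n = part_types n n"
proof (intro equalityI subsetI)
  fix x assume x: "x \<in> part_types m n"
  have "x i = 0" if "i > n" for i
    using part_types_part_le[OF x, of i] that by (cases "x i") auto
  moreover have "(\<Sum>i=1..n. i * x i) = (\<Sum>i=1..m. i * x i)"
    using assms calculation by (intro sum.mono_neutral_left) auto
  ultimately show "x \<in> part_types n n"
    using x by (auto simp: part_types_def)
next
  fix x assume x: "x \<in> part_types n n"
  then have "(\<Sum>i=1..n. i * x i) = (\<Sum>i=1..m. i * x i)"
    using assms by (intro sum.mono_neutral_left) (auto simp: part_types_def)
  then show "x \<in> part_types m n"
    using x assms by (auto simp: part_types_def)
qed

lemma gibbs_weight_eq:
  assumes "n \<le> m" "x \<in> part_types n n"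
  shows "gibbs_weight w m x = gibbs_weight w n x"
  unfolding gibbs_weight_def using assms
  by (intro prod.mono_neutral_right) (auto simp: part_types_def)

lemma sum_gibbs_weight_eq:
  assumes "n \<le> m"
  shows "(\<Sum>x\<in>part_types m n. gibbs_weight w m x) = gibbs_sum w n"
  unfolding gibbs_sum_def part_types_eq[OF assms]
  by (intro sum.cong refl gibbs_weight_eq assms)

lemma gibbs_sum_pos:
  assumes "\<And>i. i \<ge> 1 \<Longrightarrow> w i > 0"
  shows "gibbs_sum w n > 0"
proof -
  \<comment> \<open>the partition of \<open>n\<close> into blocks of size 1\<close>
  define x :: "nat \<Rightarrow> nat" where "x = (\<lambda>i. if i = 1 then n else 0)"
  have "(\<Sum>i=1..n. i * x i) = (\<Sum>i\<in>{1..n}. if i = 1 then n else 0)"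
    by (intro sum.cong) (auto simp: x_def)
  also have "\<dots> = n" by simp
  finally have "x \<in> part_types n n"
    by (auto simp: part_types_def x_def)
  moreover have "gibbs_weight w n y > 0" for y
    unfolding gibbs_weight_def using assms by (intro prod_pos) auto
  ultimately show ?thesis
    unfolding gibbs_sum_def by (intro sum_pos) auto
qed

text \<open>
  Allows the series \<^const>\<open>weight_fps\<close> to be replaced by its truncation at degree \<open>n\<close>.
\<close>

lemma fps_power_nth_cong:
  fixes f g :: "'a::comm_ring_1 fps"
  assumes "\<And>i. i \<le> n \<Longrightarrow> f $ i = g $ i"
  shows "i \<le> n \<Longrightarrow> (f ^ k) $ i = (g ^ k) $ i"
proof (induction k arbitrary: i)
  case (Suc k)
  then show ?case
    using assms by (simp add: fps_mult_nth)
qed simp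

text \<open>
  The multinomial theorem, graded by \<open>\<Sum>i. i * x i\<close>. Fixing the multiplicity \<open>j\<close> of the largest
  part size \<open>Suc m\<close> on the left corresponds to picking the \<open>j\<close>-th power of the monomial
  \<open>w (Suc m) X^(Suc m)\<close> in the binomial theorem on the right.
\<close>

lemma sum_gibbs_weight_blocks_parts_le:
  "(\<Sum>x | x \<in> part_types m n \<and> (\<Sum>i=1..m. x i) = k. gibbs_weight w m x) =
     ((\<Sum>i=1..m. fps_const (w i) * fps_X ^ i) ^ k) $ n / fact k"
proof (induction m arbitrary: n k)
  case 0
  have "{x. x \<in> part_types 0 n \<and> (\<Sum>i=1..0. x i) = k} =
      (if n = 0 \<and> k = 0 then {\<lambda>_. 0} else {})"
    by (auto simp: part_types_def)
  then show ?case
    by (cases k) (auto simp: gibbs_weight_def)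
next
  case (Suc m)
  define A where "A = (\<Sum>i=1..m. fps_const (w i) * fps_X ^ i)"
  let ?S = "\<lambda>m n k. {x. x \<in> part_types m n \<and> (\<Sum>i=1..m. x i) = k}"
  let ?J = "{j. j \<le> k \<and> Suc m * j \<le> n}"
  have J: "finite ?J" by simp
  have "(\<Sum>x\<in>?S (Suc m) n k. gibbs_weight w (Suc m) x) =
      (\<Sum>(j, x)\<in>(SIGMA j:?J. ?S m (n - Suc m * j) (k - j)).
         w (Suc m) ^ j / fact j * gibbs_weight w m x)"
  proof (rule sum.reindex_bij_witness[where j = "\<lambda>x. (x (Suc m), x(Suc m := 0))"
        and i = "\<lambda>(j, x). x(Suc m := j)"], goal_cases)
    case (1 x)
    then show ?case by simp
  next
    case (2 x)
    have "(\<Sum>i=1..m. i * (if i = Suc m then 0 else x i)) = (\<Sum>i=1..m. i * x i)"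
      "(\<Sum>i=1..m. if i = Suc m then 0 else x i) = (\<Sum>i=1..m. x i)"
      by (auto intro!: sum.cong)
    then show ?case using 2 by (auto simp: part_types_def fun_upd_def)
  next
    case (3 p)
    then show ?case by (auto simp: part_types_def fun_eq_iff)
  next
    case (4 p)
    obtain j x where p: "p = (j, x)" by (cases p)
    have "(\<Sum>i=1..m. i * (if i = Suc m then j else x i)) = (\<Sum>i=1..m. i * x i)"
      "(\<Sum>i=1..m. if i = Suc m then j else x i) = (\<Sum>i=1..m. x i)"
      by (auto intro!: sum.cong)
    then show ?case using 4 by (auto simp: part_types_def fun_upd_def p)
  next
    case (5 x)
    have "gibbs_weight w m (x(Suc m := 0)) = gibbs_weight w m x"
      unfolding gibbs_weight_def by (intro prod.cong) auto
    then show ?case by (simp add: gibbs_weight_def)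
  qed
  also have "\<dots> = (\<Sum>j\<in>?J. \<Sum>x\<in>?S m (n - Suc m * j) (k - j).
                      w (Suc m) ^ j / fact j * gibbs_weight w m x)"
    by (rule sum.Sigma[symmetric]) auto
  also have "\<dots> = (\<Sum>j\<in>?J. w (Suc m) ^ j / fact j * ((A ^ (k - j)) $ (n - Suc m * j) / fact (k - j)))"
    by (intro sum.cong refl) (simp only: sum_distrib_left[symmetric] Suc.IH A_def)
  also have "\<dots> = (\<Sum>j\<le>k. if Suc m * j \<le> n
      then w (Suc m) ^ j / fact j * ((A ^ (k - j)) $ (n - Suc m * j) / fact (k - j)) else 0)"
    by (rule sum.mono_neutral_cong_left) auto
  also have "\<dots> = (\<Sum>j\<le>k. (of_nat (k choose j) * (fps_const (w (Suc m)) * fps_X ^ Suc m) ^ j * A ^ (k - j)) $ n / fact k)"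
  proof (intro sum.cong refl)
    fix j assume j: "j \<in> {..k}"
    have "of_nat (k choose j) * (fps_const (w (Suc m)) * fps_X ^ Suc m) ^ j * A ^ (k - j) =
        fps_const (of_nat (k choose j) * w (Suc m) ^ j) * (fps_X ^ (Suc m * j) * A ^ (k - j))"
      by (simp only: power_mult_distrib fps_const_power fps_of_nat[symmetric] power_mult[symmetric] fps_const_mult[symmetric] mult.assoc)
    then have "(of_nat (k choose j) * (fps_const (w (Suc m)) * fps_X ^ Suc m) ^ j * A ^ (k - j)) $ n =
        (if Suc m * j \<le> n then real (k choose j) * w (Suc m) ^ j * (A ^ (k - j)) $ (n - Suc m * j) else 0)"
      by (simp only: fps_mult_left_const_nth fps_X_power_mult_nth) auto
    then show "(if Suc m * j \<le> n
      then w (Suc m) ^ j / fact j * ((A ^ (k - j)) $ (n - Suc m * j) / fact (k - j)) else 0) =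
      (of_nat (k choose j) * (fps_const (w (Suc m)) * fps_X ^ Suc m) ^ j * A ^ (k - j)) $ n / fact k"
      using j by (simp add: binomial_fact del: power_Suc mult_Suc)
  qed
  also have "\<dots> = ((fps_const (w (Suc m)) * fps_X ^ Suc m + A) ^ k) $ n / fact k"
    by (simp only: binomial_ring fps_sum_nth sum_divide_distrib)
  finally show ?case
    by (simp add: A_def add.commute)
qed

lemma sum_gibbs_weight_blocks:
  "(\<Sum>x | x \<in> part_types n n \<and> (\<Sum>i=1..n. x i) = k. gibbs_weight w n x) =
     (weight_fps w ^ k) $ n / fact k"
proof -
  have "((\<Sum>i=1..n. fps_const (w i) * fps_X ^ i) ^ k) $ n = (weight_fps w ^ k) $ n"
  proof (rule fps_power_nth_cong[of n])
    fix j assume "j \<le> n"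
    have "(\<Sum>i=1..n. fps_const (w i) * fps_X ^ i) $ j = (\<Sum>i\<in>{1..n}. if i = j then w i else 0)"
      by (simp only: fps_sum_nth fps_mult_left_const_nth fps_X_power_nth) (rule sum.cong, auto)
    also have "\<dots> = weight_fps w $ j"
      using \<open>j \<le> n\<close> by (simp add: weight_fps_def)
    finally show "(\<Sum>i=1..n. fps_const (w i) * fps_X ^ i) $ j = weight_fps w $ j" .
  qed simp
  then show ?thesis by (simp only: sum_gibbs_weight_blocks_parts_le)
qed

lemma part_types_blocks_le:
  assumes "x \<in> part_types m n"
  shows "(\<Sum>i=1..m. x i) \<le> n"
proof -
  have "(\<Sum>i=1..m. x i) \<le> (\<Sum>i=1..m. i * x i)" by (intro sum_mono) auto
  then show ?thesis using assms by (simp add: part_types_def)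
qed

lemma gibbs_sum_blocks: "gibbs_sum w n = (\<Sum>k\<le>n. (weight_fps w ^ k) $ n / fact k)"
proof -
  have "gibbs_sum w n =
      (\<Sum>k\<le>n. \<Sum>x | x \<in> part_types n n \<and> (\<Sum>i=1..n. x i) = k. gibbs_weight w n x)"
    unfolding gibbs_sum_def using part_types_blocks_le
    by (intro sum.group[symmetric, where g = "\<lambda>x. \<Sum>i=1..n. x i"]) auto
  then show ?thesis by (simp only: sum_gibbs_weight_blocks)
qed

text \<open>
  Removing \<open>j\<close> blocks of size \<open>r\<close> maps the vectors with \<open>x r \<ge> j\<close> bijectively onto the partitions
  of the smaller integer, and \<open>(x r choose j) / fact (x r) = 1 / (fact j * fact (x r - j))\<close>.
\<close>

lemma sum_gibbs_weight_binomial_parts_le: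
  assumes "r \<in> {1..m}"
  shows "(\<Sum>x\<in>part_types m (n + r * j). real (x r choose j) * gibbs_weight w m x) =
           w r ^ j / fact j * (\<Sum>x\<in>part_types m n. gibbs_weight w m x)"
proof -
  have split_sum: "(\<Sum>i=1..m. h i) = h r + (\<Sum>i\<in>{1..m} - {r}. h i)" for h :: "nat \<Rightarrow> nat"
    using assms by (intro sum.remove) auto
  have split_prod: "gibbs_weight w m y =
      w r ^ y r / fact (y r) * (\<Prod>i\<in>{1..m} - {r}. w i ^ y i / fact (y i))" for y
    unfolding gibbs_weight_def using assms by (intro prod.remove) auto
  have "(\<Sum>x\<in>part_types m (n + r * j). real (x r choose j) * gibbs_weight w m x) =
      (\<Sum>x | x \<in> part_types m (n + r * j) \<and> j \<le> x r. real (x r choose j) * gibbs_weight w m x)"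
    by (rule sum.mono_neutral_right) (auto simp: binomial_eq_0)
  also have "\<dots> = (\<Sum>x\<in>part_types m n. w r ^ j / fact j * gibbs_weight w m x)"
  proof (rule sum.reindex_bij_witness[where j = "\<lambda>x. x(r := x r - j)"
        and i = "\<lambda>x. x(r := x r + j)"], goal_cases)
    case (1 x)
    then show ?case by auto
  next
    case (2 x)
    have "(\<Sum>i\<in>{1..m} - {r}. i * (x(r := x r - j)) i) = (\<Sum>i\<in>{1..m} - {r}. i * x i)"
      by (intro sum.cong) auto
    moreover have "r * j \<le> r * x r" using 2 by simp
    ultimately have "(\<Sum>i=1..m. i * (x(r := x r - j)) i) = n"
      using 2 split_sum[of "\<lambda>i. i * (x(r := x r - j)) i"] split_sum[of "\<lambda>i. i * x i"]
      by (simp add: part_types_def diff_mult_distrib2)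
    with 2 assms show ?case
      by (auto simp: part_types_def)
  next
    case (3 x)
    then show ?case by auto
  next
    case (4 x)
    have "(\<Sum>i\<in>{1..m} - {r}. i * (x(r := x r + j)) i) = (\<Sum>i\<in>{1..m} - {r}. i * x i)"
      by (intro sum.cong) auto
    then have "(\<Sum>i=1..m. i * (x(r := x r + j)) i) = n + r * j"
      using 4 split_sum[of "\<lambda>i. i * (x(r := x r + j)) i"] split_sum[of "\<lambda>i. i * x i"]
      by (simp add: part_types_def algebra_simps)
    with 4 assms show ?case
      by (auto simp: part_types_def)
  next
    case (5 x)
    have "(\<Prod>i\<in>{1..m} - {r}. w i ^ (x(r := x r - j)) i / fact ((x(r := x r - j)) i)) =
        (\<Prod>i\<in>{1..m} - {r}. w i ^ x i / fact (x i))"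
      by (intro prod.cong) auto
    moreover have "w r ^ x r = w r ^ j * w r ^ (x r - j)"
      using 5 by (simp add: power_add[symmetric])
    ultimately show ?case
      using 5 by (simp add: split_prod binomial_fact)
  qed
  also have "\<dots> = w r ^ j / fact j * (\<Sum>x\<in>part_types m n. gibbs_weight w m x)"
    by (simp add: sum_distrib_left)
  finally show ?thesis .
qed

text \<open>
  After division by \<open>gibbs_sum w n\<close> this is the \<open>j\<close>-th binomial moment of the number of blocks of
  size \<open>r\<close>; as a function of \<open>n\<close> it is a shift of the normalising sums.
\<close>

lemma sum_gibbs_weight_binomial:
  assumes "r \<ge> 1"  "r \<le> n"
  shows "(\<Sum>x\<in>part_types n n. real (x r choose j) * gibbs_weight w n x) =
           (if r * j \<le> n then w r ^ j / fact j * gibbs_sum w (n - r * j) else 0)"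
proof (cases "r * j \<le> n")
  case True
  then have "(\<Sum>x\<in>part_types n n. real (x r choose j) * gibbs_weight w n x) =
      w r ^ j / fact j * (\<Sum>x\<in>part_types n (n - r * j). gibbs_weight w n x)"
    using sum_gibbs_weight_binomial_parts_le[where r = r and m = n and n = "n - r * j" and j = j and w = w] assms by simp
  with True show ?thesis by (simp add: sum_gibbs_weight_eq)
next
  case False
  have "x r < j" if "x \<in> part_types n n" for x
  proof -
    have "r * x r < r * j"
      using part_types_part_le[OF that, of r] False by linarith
    then show ?thesis by simp
  qed
  then show ?thesis using False by (auto intro!: sum.neutral simp: binomial_eq_0)
qed

section \<open>Random vectors with a Gibbs law\<close>

text \<open>
  Prescribing the probabilities of the partitions of \<open>n\<close> determines the law if the normalising sum is
  nonzero, because they then add up to 1.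
\<close>

definition gibbs_law :: "(nat \<Rightarrow> real) \<Rightarrow> nat \<Rightarrow> 'a measure \<Rightarrow> (nat \<Rightarrow> 'a \<Rightarrow> nat) \<Rightarrow> bool" where
  "gibbs_law w n \<Omega> M \<longleftrightarrow>
     prob_space \<Omega> \<and>
     (\<forall>i\<in>{1..n}. M i \<in> measurable \<Omega> (count_space UNIV)) \<and>
     (\<forall>x\<in>part_types n n. measure \<Omega> {\<omega> \<in> space \<Omega>. \<forall>i\<in>{1..n}. M i \<omega> = x i}
                          = gibbs_weight w n x / gibbs_sum w n)"

lemma gibbs_law_measurable:
  assumes "gibbs_law w n \<Omega> M"
  shows "prob_space \<Omega>" "r \<in> {1..n} \<Longrightarrow> M r \<in> measurable \<Omega> (count_space UNIV)"
    "(\<lambda>\<omega>. \<Sum>r=1..n. M r \<omega>) \<in> measurable \<Omega> (count_space UNIV)"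
proof -
  show "prob_space \<Omega>" using assms by (simp add: gibbs_law_def)
  show M: "M r \<in> measurable \<Omega> (count_space UNIV)" if "r \<in> {1..n}" for r
    using assms that by (simp add: gibbs_law_def)
  note [measurable] = M
  show "(\<lambda>\<omega>. \<Sum>r=1..n. M r \<omega>) \<in> measurable \<Omega> (count_space UNIV)"
    by measurable
qed

text \<open>
  Almost surely the vector is a partition of \<open>n\<close>, so up to a null set an event is a finite disjoint
  union of events that fix the whole vector.
\<close>

lemma gibbs_law_event:
  assumes law: "gibbs_law w n \<Omega> M" and pos: "gibbs_sum w n > 0"
    and P: "\<And>\<omega>. \<omega> \<in> space \<Omega> \<Longrightarrow> R \<omega> \<longleftrightarrow> P (\<lambda>i. if i \<in> {1..n} then M i \<omega> else 0)"
    and meas: "{\<omega> \<in> space \<Omega>. R \<omega>} \<in> sets \<Omega>"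
  shows "measure \<Omega> {\<omega> \<in> space \<Omega>. R \<omega>} =
           (\<Sum>x | x \<in> part_types n n \<and> P x. gibbs_weight w n x) / gibbs_sum w n"
proof -
  interpret prob_space \<Omega> using law by (simp add: gibbs_law_def)
  define V where "V \<omega> = (\<lambda>i. if i \<in> {1..n} then M i \<omega> else 0)" for \<omega>
  define A where "A x = {\<omega> \<in> space \<Omega>. \<forall>i\<in>{1..n}. M i \<omega> = x i}" for x
  have A_iff: "\<omega> \<in> A x \<longleftrightarrow> \<omega> \<in> space \<Omega> \<and> V \<omega> = x" if "x \<in> part_types n n" for \<omega> x
    using that by (auto simp: A_def V_def fun_eq_iff part_types_def)
  have A_sets: "A x \<in> sets \<Omega>" for x
  proof -
    have "{\<omega> \<in> space \<Omega>. M i \<omega> = x i} \<in> sets \<Omega>" if "i \<in> {1..n}" for i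
    proof -
      have "M i -` {x i} \<inter> space \<Omega> \<in> sets \<Omega>"
        using law that by (intro measurable_sets[of _ _ "count_space UNIV"]) (auto simp: gibbs_law_def)
      also have "M i -` {x i} \<inter> space \<Omega> = {\<omega> \<in> space \<Omega>. M i \<omega> = x i}" by auto
      finally show ?thesis .
    qed
    then show ?thesis unfolding A_def by (intro sets.sets_Collect_finite_All) auto
  qed
  have prob_A: "prob (A x) = gibbs_weight w n x / gibbs_sum w n" if "x \<in> part_types n n" for x
    using law that by (simp add: gibbs_law_def A_def)
  have prob_UN: "prob (\<Union>x\<in>S. A x) = (\<Sum>x\<in>S. gibbs_weight w n x) / gibbs_sum w n"
    if "S \<subseteq> part_types n n" for S
  proof -
    have "prob (\<Union>x\<in>S. A x) = (\<Sum>x\<in>S. prob (A x))"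
    proof (rule finite_measure_finite_Union)
      show "finite S" using that finite_part_types by (rule finite_subset)
      show "A ` S \<subseteq> sets \<Omega>" using A_sets by auto
      show "disjoint_family_on A S"
        unfolding disjoint_family_on_def using that by (auto simp: A_iff subset_iff)
    qed
    also have "\<dots> = (\<Sum>x\<in>S. gibbs_weight w n x / gibbs_sum w n)"
      using that by (intro sum.cong refl prob_A) auto
    finally show ?thesis by (simp add: sum_divide_distrib)
  qed
  have "prob (\<Union>x\<in>part_types n n. A x) = 1"
    using pos by (subst prob_UN) (auto simp: gibbs_sum_def)
  then have "AE \<omega> in \<Omega>. \<omega> \<in> (\<Union>x\<in>part_types n n. A x)"
    using A_sets by (intro AE_prob_1) 
  then have "measure \<Omega> {\<omega> \<in> space \<Omega>. R \<omega>} = prob (\<Union>x\<in>{x \<in> part_types n n. P x}. A x)"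
  proof (intro finite_measure_eq_AE)
    assume "AE \<omega> in \<Omega>. \<omega> \<in> (\<Union>x\<in>part_types n n. A x)"
    then show "AE \<omega> in \<Omega>. (\<omega> \<in> {\<omega> \<in> space \<Omega>. R \<omega>}) = (\<omega> \<in> (\<Union>x\<in>{x \<in> part_types n n. P x}. A x))"
    proof eventually_elim
      case (elim \<omega>)
      then obtain x where x: "x \<in> part_types n n" "\<omega> \<in> A x" by auto
      then have V: "\<omega> \<in> space \<Omega>" "V \<omega> = x" by (simp_all add: A_iff)
      have "R \<omega> \<longleftrightarrow> P x" using P[OF V(1)] V(2) by (simp add: V_def)
      then show ?case using V x by (auto simp: A_iff)
    qed
    show "{\<omega> \<in> space \<Omega>. R \<omega>} \<in> sets \<Omega>" by (rule meas)
    show "(\<Union>x\<in>{x \<in> part_types n n. P x}. A x) \<in> sets \<Omega>"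
      using A_sets finite_part_types by (intro sets.finite_UN) auto
  qed
  then show ?thesis by (simp add: prob_UN)
qed

text \<open>
  With \<open>Q\<close> a singleton this is the law of the number of blocks; with \<open>Q\<close> an inequality it gives
  the tails.
\<close>

lemma gibbs_law_blocks:
  assumes law: "gibbs_law w n \<Omega> M" and pos: "gibbs_sum w n > 0"
  shows "measure \<Omega> {\<omega> \<in> space \<Omega>. Q (\<Sum>r=1..n. M r \<omega>)} =
           (\<Sum>k | k \<le> n \<and> Q k. (weight_fps w ^ k) $ n / fact k / gibbs_sum w n)"
proof -
  have "(\<lambda>\<omega>. \<Sum>r=1..n. M r \<omega>) -` {k. Q k} \<inter> space \<Omega> \<in> sets \<Omega>"
    using gibbs_law_measurable(3)[OF law] by (rule measurable_sets) simp
  also have "(\<lambda>\<omega>. \<Sum>r=1..n. M r \<omega>) -` {k. Q k} \<inter> space \<Omega> = {\<omega> \<in> space \<Omega>. Q (\<Sum>r=1..n. M r \<omega>)}"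
    by auto
  finally have sets: "{\<omega> \<in> space \<Omega>. Q (\<Sum>r=1..n. M r \<omega>)} \<in> sets \<Omega>" .
  have "measure \<Omega> {\<omega> \<in> space \<Omega>. Q (\<Sum>r=1..n. M r \<omega>)} =
      (\<Sum>x | x \<in> part_types n n \<and> Q (\<Sum>i=1..n. x i). gibbs_weight w n x) / gibbs_sum w n"
  proof (rule gibbs_law_event[OF law pos, where P = "\<lambda>x. Q (\<Sum>i=1..n. x i)"])
    fix \<omega>
    have "(\<Sum>r=1..n. M r \<omega>) = (\<Sum>i=1..n. if i \<in> {1..n} then M i \<omega> else 0)"
      by (intro sum.cong) auto
    then show "Q (\<Sum>r=1..n. M r \<omega>) = Q (\<Sum>i=1..n. if i \<in> {1..n} then M i \<omega> else 0)"
      by simp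
  qed (rule sets)
  also have "(\<Sum>x | x \<in> part_types n n \<and> Q (\<Sum>i=1..n. x i). gibbs_weight w n x) =
      (\<Sum>k | k \<le> n \<and> Q k. \<Sum>x | x \<in> {x \<in> part_types n n. Q (\<Sum>i=1..n. x i)} \<and> (\<Sum>i=1..n. x i) = k.
         gibbs_weight w n x)"
    using part_types_blocks_le
    by (intro sum.group[symmetric, where g = "\<lambda>x. \<Sum>i=1..n. x i"]) auto
  also have "\<dots> = (\<Sum>k | k \<le> n \<and> Q k. \<Sum>x | x \<in> part_types n n \<and> (\<Sum>i=1..n. x i) = k. gibbs_weight w n x)"
    by (intro sum.cong refl) auto
  finally show ?thesis
    by (simp only: sum_gibbs_weight_blocks sum_divide_distrib)
qed

text \<open>
  Inclusion-exclusion, by which binomial moments determine point probabilities: the sum is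
  \<open>x choose k\<close> times the alternating sum of row \<open>x - k\<close> of Pascal's triangle. The bound \<open>N\<close> lets the
  same range serve for all \<open>x\<close>.
\<close>

lemma indicator_eq_binomial_sum:
  assumes "x \<le> N"
  shows "of_bool (x = k) = (\<Sum>j\<le>N. (-1) ^ j * real ((j + k) choose k) * real (x choose (j + k)))"
proof (cases "k \<le> x")
  case True
  have "(\<Sum>j\<le>N. (-1) ^ j * real ((j + k) choose k) * real (x choose (j + k))) =
      (\<Sum>j\<le>x - k. (-1) ^ j * real ((j + k) choose k) * real (x choose (j + k)))"
    using assms True by (intro sum.mono_neutral_right) auto
  also have "\<dots> = (\<Sum>j\<le>x - k. real (x choose k) * ((-1) ^ j * real ((x - k) choose j)))"
  proof (intro sum.cong refl)
    fix j assume "j \<in> {..x - k}"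
    then have "(x choose (j + k)) * ((j + k) choose k) = (x choose k) * ((x - k) choose j)"
      using choose_mult[of k "j + k" x] True by simp
    then have "real ((x choose (j + k)) * ((j + k) choose k)) = real ((x choose k) * ((x - k) choose j))"
      by simp
    then show "(-1) ^ j * real ((j + k) choose k) * real (x choose (j + k)) =
        real (x choose k) * ((-1) ^ j * real ((x - k) choose j))"
      by (simp add: mult_ac)
  qed
  also have "\<dots> = real (x choose k) * of_bool (x = k)"
    using True choose_alternating_sum[of "x - k", where ?'a = real]
    by (cases "x = k") (auto simp: sum_distrib_left[symmetric])
  finally show ?thesis using True by simp
next
  case False
  then show ?thesis by (auto simp: binomial_eq_0)
qed

text \<open>
  The binomial moments inverted. The sum over \<open>j\<close> is finite; it is written as a series whose range
  does not depend on \<open>n\<close> so that limits can be taken term by term.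
\<close>

lemma gibbs_law_multiplicity:
  assumes law: "gibbs_law w n \<Omega> M" and pos: "gibbs_sum w n > 0" and r: "1 \<le> r" "r \<le> n"
  shows "measure \<Omega> {\<omega> \<in> space \<Omega>. M r \<omega> = k} =
     w r ^ k / fact k * (\<Sum>j. if r * (j + k) \<le> n
        then (- w r) ^ j / fact j * (gibbs_sum w (n - r * (j + k)) / gibbs_sum w n) else 0)"
proof -
  have [measurable]: "M r \<in> measurable \<Omega> (count_space UNIV)"
    using law r by (simp add: gibbs_law_def)
  let ?t = "\<lambda>j. if r * (j + k) \<le> n
        then (- w r) ^ j / fact j * (gibbs_sum w (n - r * (j + k)) / gibbs_sum w n) else 0"
  have "(\<Sum>x | x \<in> part_types n n \<and> x r = k. gibbs_weight w n x) =
      (\<Sum>x\<in>part_types n n. of_bool (x r = k) * gibbs_weight w n x)"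
    by (rule sum.mono_neutral_cong_left) auto
  also have "\<dots> = (\<Sum>x\<in>part_types n n. \<Sum>j\<le>n.
      (-1) ^ j * real ((j + k) choose k) * (real (x r choose (j + k)) * gibbs_weight w n x))"
    by (intro sum.cong refl)
      (simp only: indicator_eq_binomial_sum[OF part_types_le] sum_distrib_right mult.assoc)
  also have "\<dots> = (\<Sum>j\<le>n. (-1) ^ j * real ((j + k) choose k) *
      (\<Sum>x\<in>part_types n n. real (x r choose (j + k)) * gibbs_weight w n x))"
    by (subst sum.swap) (simp add: sum_distrib_left)
  also have "\<dots> = (\<Sum>j\<le>n. w r ^ k / fact k * gibbs_sum w n * ?t j)"
  proof (intro sum.cong refl)
    fix j
    have binom: "real ((j + k) choose k) = fact (j + k) / (fact k * fact j)"
      by (simp add: binomial_fact)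
    have sign: "(- w r) ^ j = (-1) ^ j * w r ^ j"
      by (rule power_minus)
    show "(-1) ^ j * real ((j + k) choose k) *
        (\<Sum>x\<in>part_types n n. real (x r choose (j + k)) * gibbs_weight w n x) =
        w r ^ k / fact k * gibbs_sum w n * ?t j"
      unfolding sum_gibbs_weight_binomial[OF r] binom sign power_add
      using pos by (simp add: mult_ac)
  qed
  also have "\<dots> = w r ^ k / fact k * gibbs_sum w n * (\<Sum>j. ?t j)"
  proof -
    have "(\<Sum>j. ?t j) = (\<Sum>j\<le>n. ?t j)"
    proof (rule suminf_finite)
      fix j assume "j \<notin> {..n}"
      then have "n < j" by simp
      also have "j \<le> r * (j + k)" using mult_le_mono[of 1 r j "j + k"] r by simp
      finally show "?t j = 0" by simp
    qed simp
    then show ?thesis by (simp only: sum_distrib_left)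
  qed
  finally have "(\<Sum>x | x \<in> part_types n n \<and> x r = k. gibbs_weight w n x) = \<dots>" .
  moreover have "measure \<Omega> {\<omega> \<in> space \<Omega>. M r \<omega> = k} =
      (\<Sum>x | x \<in> part_types n n \<and> x r = k. gibbs_weight w n x) / gibbs_sum w n"
  proof (rule gibbs_law_event[OF law pos, where P = "\<lambda>x. x r = k"])
    fix \<omega>
    show "(M r \<omega> = k) = ((if r \<in> {1..n} then M r \<omega> else 0) = k)"
      using r by simp
  qed measurable
  ultimately show ?thesis using pos by simp
qed

section \<open>Weak convergence from point and tail probabilities\<close>

text \<open>
  For a variable with values in the natural numbers the distribution function at \<open>x\<close> is a finite
  sum of point probabilities, over \<open>0, \<dots>, \<lfloor>x\<rfloor>\<close>, and its range does not depend on \<open>n\<close>. Measurability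
  is required only eventually since blocks of size \<open>r\<close> are observed only for \<open>n \<ge> r\<close>.
\<close>

lemma weak_conv_m_nat:
  fixes N :: "nat \<Rightarrow> 'a \<Rightarrow> nat" and N' :: "'b \<Rightarrow> nat"
  assumes N: "eventually (\<lambda>n. prob_space (\<Omega> n) \<and> N n \<in> measurable (\<Omega> n) (count_space UNIV)) sequentially"
    and N': "prob_space \<Omega>'" "N' \<in> measurable \<Omega>' (count_space UNIV)"
    and lim: "\<And>k. (\<lambda>n. measure (\<Omega> n) {\<omega> \<in> space (\<Omega> n). N n \<omega> = k})
                     \<longlonglongrightarrow> measure \<Omega>' {\<omega> \<in> space \<Omega>'. N' \<omega> = k}"
  shows "weak_conv_m (\<lambda>n. distr (\<Omega> n) borel (\<lambda>\<omega>. real (N n \<omega>))) (distr \<Omega>' borel (\<lambda>\<omega>. real (N' \<omega>)))"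
proof -
  have cdf_eq: "cdf (distr P borel (\<lambda>\<omega>. real (X \<omega>))) x =
      (\<Sum>k | real k \<le> x. measure P {\<omega> \<in> space P. X \<omega> = k})"
    if "prob_space P" and X: "X \<in> measurable P (count_space UNIV)" for P :: "'c measure" and X x
  proof -
    interpret prob_space P by fact
    have fin: "finite {k. real k \<le> x}"
    proof (rule finite_subset)
      show "{k. real k \<le> x} \<subseteq> {..nat \<lfloor>x\<rfloor>}" by (auto simp: le_nat_floor)
    qed simp
    have "(\<lambda>\<omega>. real (X \<omega>)) \<in> measurable P borel"
      using X by measurable
    then have "cdf (distr P borel (\<lambda>\<omega>. real (X \<omega>))) x = prob {\<omega> \<in> space P. real (X \<omega>) \<le> x}"
      unfolding cdf_def by (subst measure_distr) (auto intro!: arg_cong[where f = prob])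
    also have "{\<omega> \<in> space P. real (X \<omega>) \<le> x} = (\<Union>k\<in>{k. real k \<le> x}. {\<omega> \<in> space P. X \<omega> = k})"
      by auto
    also have "prob \<dots> = (\<Sum>k | real k \<le> x. prob {\<omega> \<in> space P. X \<omega> = k})"
      using fin X by (intro finite_measure_finite_Union) (auto simp: disjoint_family_on_def)
    finally show ?thesis .
  qed
  show ?thesis
    unfolding weak_conv_m_def weak_conv_def
  proof (intro allI impI)
    fix x
    have "(\<lambda>n. \<Sum>k | real k \<le> x. measure (\<Omega> n) {\<omega> \<in> space (\<Omega> n). N n \<omega> = k})
        \<longlonglongrightarrow> (\<Sum>k | real k \<le> x. measure \<Omega>' {\<omega> \<in> space \<Omega>'. N' \<omega> = k})"
      by (intro tendsto_sum lim)
    moreover have "eventually (\<lambda>n. (\<Sum>k | real k \<le> x. measure (\<Omega> n) {\<omega> \<in> space (\<Omega> n). N n \<omega> = k}) =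
        cdf (distr (\<Omega> n) borel (\<lambda>\<omega>. real (N n \<omega>))) x) sequentially"
      using N by eventually_elim (simp add: cdf_eq)
    ultimately show "(\<lambda>n. cdf (distr (\<Omega> n) borel (\<lambda>\<omega>. real (N n \<omega>))) x)
        \<longlonglongrightarrow> cdf (distr \<Omega>' borel (\<lambda>\<omega>. real (N' \<omega>))) x"
      unfolding cdf_eq[OF N'] by (rule Lim_transform_eventually)
  qed
qed

text \<open>
  The distribution function of a constant \<open>c\<close> is discontinuous at \<open>c\<close>, so only points on either
  side of \<open>c\<close> have to be considered.
\<close>

lemma weak_conv_m_const:
  assumes X: "eventually (\<lambda>n. prob_space (\<Omega> n) \<and> X n \<in> borel_measurable (\<Omega> n)) sequentially"
    and below: "\<And>s. s < c \<Longrightarrow> (\<lambda>n. measure (\<Omega> n) {\<omega> \<in> space (\<Omega> n). X n \<omega> \<le> s}) \<longlonglongrightarrow> 0"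
    and above: "\<And>s. s > c \<Longrightarrow> (\<lambda>n. measure (\<Omega> n) {\<omega> \<in> space (\<Omega> n). X n \<omega> > s}) \<longlonglongrightarrow> 0"
  shows "weak_conv_m (\<lambda>n. distr (\<Omega> n) borel (X n)) (return borel (c :: real))"
  unfolding weak_conv_m_def weak_conv_def
proof (intro allI impI)
  fix s assume cont: "isCont (cdf (return borel c)) s"
  have cdf_c: "cdf (return borel c) x = (if c \<le> x then 1 else 0)" for x
    unfolding cdf_def by (subst measure_return) auto
  \<comment> \<open>the distribution function is 0 to the left of \<open>c\<close> and 1 at \<open>c\<close>\<close>
  have "s \<noteq> c"
  proof
    assume [simp]: "s = c"
    have "(cdf (return borel c) \<longlongrightarrow> cdf (return borel c) c) (at_left c)"
      using cont by (simp add: continuous_within isCont_def filterlim_at_split)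
    then have "(cdf (return borel c) \<longlongrightarrow> 1) (at_left c)" by (simp add: cdf_c)
    moreover have "eventually (\<lambda>x. cdf (return borel c) x = 0) (at_left c)"
      unfolding eventually_at_filter by (simp add: cdf_c)
    then have "(cdf (return borel c) \<longlongrightarrow> 0) (at_left c)"
      by (rule tendsto_eventually)
    ultimately show False
      using tendsto_unique[of "at_left c"] by fastforce
  qed
  have le: "eventually (\<lambda>n. cdf (distr (\<Omega> n) borel (X n)) s = measure (\<Omega> n) {\<omega> \<in> space (\<Omega> n). X n \<omega> \<le> s}) sequentially"
    using X
  proof eventually_elim
    case (elim n)
    then show ?case
      unfolding cdf_def by (subst measure_distr) (auto intro!: arg_cong[where f = "measure (\<Omega> n)"])
  qed
  consider "s < c" | "s > c" using \<open>s \<noteq> c\<close> by linarith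
  then show "(\<lambda>n. cdf (distr (\<Omega> n) borel (X n)) s) \<longlonglongrightarrow> cdf (return borel c) s"
  proof cases
    case 1
    have "eventually (\<lambda>n. measure (\<Omega> n) {\<omega> \<in> space (\<Omega> n). X n \<omega> \<le> s} = cdf (distr (\<Omega> n) borel (X n)) s) sequentially"
      using le by eventually_elim simp
    with below[OF 1] have "(\<lambda>n. cdf (distr (\<Omega> n) borel (X n)) s) \<longlonglongrightarrow> 0"
      by (rule Lim_transform_eventually)
    then show ?thesis using 1 by (simp add: cdf_c)
  next
    case 2
    have "(\<lambda>n. 1 - measure (\<Omega> n) {\<omega> \<in> space (\<Omega> n). X n \<omega> > s}) \<longlonglongrightarrow> 1 - 0"
      by (intro tendsto_intros above 2)
    moreover have "eventually (\<lambda>n. 1 - measure (\<Omega> n) {\<omega> \<in> space (\<Omega> n). X n \<omega> > s} =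
        cdf (distr (\<Omega> n) borel (X n)) s) sequentially"
      using le X
    proof eventually_elim
      case (elim n)
      then interpret prob_space "\<Omega> n" by simp
      have [measurable]: "X n \<in> borel_measurable (\<Omega> n)" using elim by simp
      have "prob {\<omega> \<in> space (\<Omega> n). \<not> X n \<omega> > s} = 1 - prob {\<omega> \<in> space (\<Omega> n). X n \<omega> > s}"
        by (intro prob_neg) measurable
      then show ?case using elim by (simp add: not_less)
    qed
    ultimately show ?thesis
      using 2 by (auto simp: cdf_c intro: Lim_transform_eventually)
  qed
qed

section \<open>Poisson limits of multiplicities\<close>

lemma ratio_tendsto_1_shift:
  fixes c :: "nat \<Rightarrow> real"
  assumes pos: "\<And>n. c n > 0" and lim: "(\<lambda>n. c n / c (Suc n)) \<longlonglongrightarrow> 1"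
  shows "(\<lambda>n. c (n - m) / c n) \<longlonglongrightarrow> 1"
proof (induction m)
  case 0
  have "c n / c n = 1" for n using pos[of n] by simp
  then show ?case by simp
next
  case (Suc m)
  have "(\<lambda>n. c n / c (Suc n) * (c (Suc n - m) / c (Suc n)) * (c (n - m) / c n) / (c (Suc n - m) / c (Suc n)))
      \<longlonglongrightarrow> 1 * 1 * 1 / 1"
    by (intro tendsto_intros lim Suc LIMSEQ_Suc[OF Suc]) auto
  moreover have "c n / c (Suc n) * (c (Suc n - m) / c (Suc n)) * (c (n - m) / c n) / (c (Suc n - m) / c (Suc n))
      = c (Suc n - Suc m) / c (Suc n)" for n
    using pos[of n] pos[of "Suc n"] pos[of "Suc n - m"] by (simp add: field_simps)
  ultimately have "(\<lambda>n. c (Suc n - Suc m) / c (Suc n)) \<longlonglongrightarrow> 1" by simp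
  then show ?case by (rule LIMSEQ_imp_Suc)
qed

text \<open>
  A convergent sequence of quotients is bounded. The resulting geometric bound is the majorant for
  the interchange of limit and series below.
\<close>

lemma ratio_tendsto_1_bound:
  fixes c :: "nat \<Rightarrow> real"
  assumes pos: "\<And>n. c n > 0" and lim: "(\<lambda>n. c n / c (Suc n)) \<longlonglongrightarrow> 1"
  obtains B where "B \<ge> 1" "\<And>m n. m \<le> n \<Longrightarrow> c (n - m) / c n \<le> B ^ m"
proof -
  obtain B0 where B0: "\<And>n. norm (c n / c (Suc n)) \<le> B0"
    using convergent_imp_Bseq[OF convergentI[OF lim]] by (auto simp: Bseq_def)
  define B where "B = max B0 1"
  have B: "c n \<le> B * c (Suc n)" for n
    using B0[of n] pos[of n] pos[of "Suc n"] by (auto simp: B_def divide_le_eq max_def mult_right_mono intro: order_trans)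
  have "c n \<le> B ^ m * c (n + m)" for m n
  proof (induction m)
    case (Suc m)
    have "c n \<le> B ^ m * c (n + m)" by (rule Suc)
    also have "\<dots> \<le> B ^ m * (B * c (Suc (n + m)))"
      by (intro mult_left_mono B) (simp add: B_def)
    finally show ?case by (simp add: mult_ac)
  qed simp
  then have "c (n - m) / c n \<le> B ^ m" if "m \<le> n" for m n
    using that pos[of n] by (metis divide_le_eq le_add_diff_inverse2)
  then show ?thesis using that[of B] by (simp add: B_def)
qed

text \<open>
  Every term tends to \<open>u ^ j / fact j\<close>, and the terms are dominated by a constant times
  \<open>(\<bar>u\<bar> * B ^ r) ^ j / fact j\<close>, so Tannery's theorem applies.
\<close>

lemma poisson_sum_limit:
  fixes c :: "nat \<Rightarrow> real"
  assumes pos: "\<And>n. c n > 0" and lim: "(\<lambda>n. c n / c (Suc n)) \<longlonglongrightarrow> 1"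
  shows "(\<lambda>n. \<Sum>j. if r * (j + k) \<le> n then u ^ j / fact j * (c (n - r * (j + k)) / c n) else 0) \<longlonglongrightarrow> exp u"
proof -
  obtain B where B: "B \<ge> 1" "\<And>m n. m \<le> n \<Longrightarrow> c (n - m) / c n \<le> B ^ m"
    using ratio_tendsto_1_bound[OF pos lim] by blast
  let ?a = "\<lambda>j n. if r * (j + k) \<le> n then u ^ j / fact j * (c (n - r * (j + k)) / c n) else 0"
  let ?M = "\<lambda>j. B ^ (r * k) * ((\<bar>u\<bar> * B ^ r) ^ j / fact j)"
  have "eventually (\<lambda>n. summable (\<lambda>j. norm (?a j n))) sequentially \<and>
      summable (\<lambda>j. norm (u ^ j / fact j)) \<and> ((\<lambda>n. \<Sum>j. ?a j n) \<longlonglongrightarrow> (\<Sum>j. u ^ j / fact j))"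
  proof (rule tannerys_theorem)
    fix j
    have "(\<lambda>n. u ^ j / fact j * (c (n - r * (j + k)) / c n)) \<longlonglongrightarrow> u ^ j / fact j * 1"
      by (intro tendsto_intros ratio_tendsto_1_shift pos lim)
    moreover have "eventually (\<lambda>n. u ^ j / fact j * (c (n - r * (j + k)) / c n) = ?a j n) sequentially"
      using eventually_ge_at_top[of "r * (j + k)"] by eventually_elim simp
    ultimately have "(\<lambda>n. ?a j n) \<longlonglongrightarrow> u ^ j / fact j * 1" by (rule Lim_transform_eventually)
    then show "(\<lambda>n. ?a j n) \<longlonglongrightarrow> u ^ j / fact j" by simp
  next
    have "norm (?a j n) \<le> ?M j" for j n
    proof (cases "r * (j + k) \<le> n")
      case True
      have "norm (?a j n) = \<bar>u\<bar> ^ j / fact j * (c (n - r * (j + k)) / c n)"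
        using True pos[of n] pos[of "n - r * (j + k)"] by (simp add: abs_mult power_abs)
      also have "\<dots> \<le> \<bar>u\<bar> ^ j / fact j * B ^ (r * (j + k))"
        by (intro mult_left_mono B True) auto
      also have "\<dots> = ?M j"
        by (simp add: power_mult_distrib power_add power_mult[symmetric] algebra_simps)
      finally show ?thesis .
    next
      case False
      then show ?thesis using B(1) by simp
    qed
    then show "eventually (\<lambda>(j, n). norm (?a j n) \<le> ?M j) (at_top \<times>\<^sub>F sequentially)"
      by (intro always_eventually) auto
  next
    have "summable (\<lambda>j. (\<bar>u\<bar> * B ^ r) ^ j / fact j)"
      using summable_exp_generic[of "\<bar>u\<bar> * B ^ r"] by (simp add: divide_inverse mult_ac)
    then show "summable ?M" by (rule summable_mult)
  qed simp
  moreover have "(\<Sum>j. u ^ j / fact j) = exp u"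
    by (simp add: exp_def divide_inverse mult_ac)
  ultimately show ?thesis by simp
qed

lemma measure_poisson_single:
  assumes "c > 0"
  shows "measure (measure_pmf (poisson_pmf c)) {j \<in> space (measure_pmf (poisson_pmf c)). j = k} =
           c ^ k / fact k * exp (- c)"
proof -
  have "{j \<in> space (measure_pmf (poisson_pmf c)). j = k} = {k}" by auto
  then show ?thesis using assms by (simp add: measure_pmf_single)
qed

text \<open>
  Asymptotic equality of consecutive normalising sums makes the \<open>j\<close>-th binomial moment tend to
  \<open>w r ^ j / fact j\<close>, which is that of the Poisson law with mean \<open>w r\<close>.
\<close>

lemma gibbs_multiplicity_weak_limit:
  assumes law: "\<And>n. n \<ge> 1 \<Longrightarrow> gibbs_law w n (\<Omega> n) (M n)"
    and w: "\<And>i. i \<ge> 1 \<Longrightarrow> w i > 0"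
    and ratio: "(\<lambda>n. gibbs_sum w n / gibbs_sum w (Suc n)) \<longlonglongrightarrow> 1"
    and r: "r \<ge> 1"
  shows "weak_conv_m (\<lambda>n. distr (\<Omega> n) borel (\<lambda>\<omega>. real (M n r \<omega>)))
           (distr (measure_pmf (poisson_pmf (w r))) borel real)"
proof (rule weak_conv_m_nat[where N' = "\<lambda>j. j"])
  show "eventually (\<lambda>n. prob_space (\<Omega> n) \<and> M n r \<in> measurable (\<Omega> n) (count_space UNIV)) sequentially"
    using eventually_ge_at_top[of r]
    by eventually_elim (use r gibbs_law_measurable[OF law] in auto)
  show "prob_space (measure_pmf (poisson_pmf (w r)))" by (rule prob_space_measure_pmf)
  fix k
  have pos: "gibbs_sum w n > 0" for n by (rule gibbs_sum_pos[OF w])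
  have "(\<lambda>n. w r ^ k / fact k * (\<Sum>j. if r * (j + k) \<le> n
        then (- w r) ^ j / fact j * (gibbs_sum w (n - r * (j + k)) / gibbs_sum w n) else 0))
      \<longlonglongrightarrow> w r ^ k / fact k * exp (- w r)"
    by (intro tendsto_intros poisson_sum_limit pos ratio)
  moreover have "eventually (\<lambda>n. w r ^ k / fact k * (\<Sum>j. if r * (j + k) \<le> n
        then (- w r) ^ j / fact j * (gibbs_sum w (n - r * (j + k)) / gibbs_sum w n) else 0) =
      measure (\<Omega> n) {\<omega> \<in> space (\<Omega> n). M n r \<omega> = k}) sequentially"
    using eventually_ge_at_top[of r]
  proof eventually_elim
    case (elim n)
    then show ?case using gibbs_law_multiplicity[OF law pos r elim] r by simp
  qed
  ultimately show "(\<lambda>n. measure (\<Omega> n) {\<omega> \<in> space (\<Omega> n). M n r \<omega> = k}) \<longlonglongrightarrow>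
      measure (measure_pmf (poisson_pmf (w r))) {j \<in> space (measure_pmf (poisson_pmf (w r))). j = k}"
    using w[OF r] by (subst measure_poisson_single) (auto intro: Lim_transform_eventually)
qed simp

section \<open>Generalized factorial coefficients as coefficients of power series\<close>

text \<open>
  The series of \<open>(1 - X)\<close> raised to the power \<open>- s\<close>.
\<close>

definition poch_fps :: "real \<Rightarrow> real fps" where
  "poch_fps s = Abs_fps (\<lambda>n. pochhammer s n / fact n)"

lemma poch_fps_nth [simp]: "poch_fps s $ n = pochhammer s n / fact n"
  by (simp add: poch_fps_def)

lemma poch_fps_0 [simp]: "poch_fps 0 = 1"
  by (rule fps_ext) (auto simp: pochhammer_0_left)

text \<open>
  Vandermonde's identity for ascending factorials, as the addition law of exponents.
\<close>

lemma poch_fps_add: "poch_fps (a + b) = poch_fps a * poch_fps b"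
proof (rule fps_ext)
  fix n
  have "poch_fps (a + b) $ n =
      (\<Sum>k\<le>n. real (n choose k) * pochhammer a k * pochhammer b (n - k) / fact n)"
    by (simp add: pochhammer_binomial_sum sum_divide_distrib)
  also have "\<dots> = (\<Sum>k\<le>n. (pochhammer a k / fact k) * (pochhammer b (n - k) / fact (n - k)))"
    by (intro sum.cong refl) (simp add: binomial_fact)
  finally show "poch_fps (a + b) $ n = (poch_fps a * poch_fps b) $ n"
    by (simp add: fps_mult_nth atLeast0AtMost)
qed

lemma poch_fps_power: "poch_fps a ^ k = poch_fps (real k * a)"
  by (induction k) (simp_all add: poch_fps_add algebra_simps)

text \<open>
  The series \<open>1 - (1 - X)^\<alpha>\<close>, whose \<open>j\<close>-th power has the coefficients
  \<open>fact j / fact n * gen_fact_coeff n j \<alpha>\<close>.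
\<close>

definition gfc_fps :: "real \<Rightarrow> real fps" where
  "gfc_fps \<alpha> = 1 - poch_fps (- \<alpha>)"

lemma gfc_fps_power_nth:
  "(gfc_fps \<alpha> ^ k) $ n =
     (\<Sum>i\<le>k. real (k choose i) * (-1) ^ i * pochhammer (- real i * \<alpha>) n) / fact n"
proof -
  have "gfc_fps \<alpha> ^ k = (- poch_fps (- \<alpha>) + 1) ^ k"
    by (simp add: gfc_fps_def)
  also have "\<dots> = (\<Sum>i\<le>k. of_nat (k choose i) * (- poch_fps (- \<alpha>)) ^ i * 1 ^ (k - i))"
    by (rule binomial_ring)
  also have "\<dots> = (\<Sum>i\<le>k. fps_const (real (k choose i) * (-1) ^ i) * poch_fps (- real i * \<alpha>))"
  proof (intro sum.cong refl)
    fix i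
    have "(- poch_fps (- \<alpha>)) ^ i = (-1) ^ i * poch_fps (- real i * \<alpha>)"
      by (subst power_minus) (simp add: poch_fps_power)
    also have "(-1 :: real fps) ^ i = fps_const ((-1) ^ i)"
      by (simp add: fps_const_power[symmetric] fps_const_neg[symmetric] del: fps_const_power fps_const_neg)
    finally show "of_nat (k choose i) * (- poch_fps (- \<alpha>)) ^ i * 1 ^ (k - i) =
        fps_const (real (k choose i) * (-1) ^ i) * poch_fps (- real i * \<alpha>)"
      by (simp only: fps_of_nat[symmetric] fps_const_mult[symmetric] mult.assoc power_one mult_1_right)
  qed
  finally show ?thesis
    by (simp add: fps_sum_nth sum_divide_distrib)
qed

lemma gen_fact_coeff_eq: "gen_fact_coeff n j \<alpha> = fact n / fact j * (gfc_fps \<alpha> ^ j) $ n"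
  by (simp add: gen_fact_coeff_def gfc_fps_power_nth)

lemma pochhammer_uminus: "n \<ge> 1 \<Longrightarrow> pochhammer (- \<alpha>) n = - \<alpha> * pochhammer (1 - \<alpha>) (n - 1)" for \<alpha> :: real
  by (cases n) (simp_all add: pochhammer_rec)

lemma gfc_fps_nth: "gfc_fps \<alpha> $ n = (if n = 0 then 0 else \<alpha> * pochhammer (1 - \<alpha>) (n - 1) / fact n)"
  using pochhammer_uminus[of n \<alpha>] by (simp add: gfc_fps_def)

lemma gfc_fps_power_nth_eq_0: "n < k \<Longrightarrow> (gfc_fps \<alpha> ^ k) $ n = 0"
  by (rule startsby_zero_power_prefix[rule_format]) (simp_all add: gfc_fps_nth)

definition cpsm_weight :: "real \<Rightarrow> real \<Rightarrow> nat \<Rightarrow> real" where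
  "cpsm_weight \<alpha> z i = z * (\<alpha> * pochhammer (1 - \<alpha>) (i - 1) / fact i)"

lemma weight_fps_cpsm: "weight_fps (cpsm_weight \<alpha> z) = fps_const z * gfc_fps \<alpha>"
  by (rule fps_ext) (simp add: weight_fps_def cpsm_weight_def gfc_fps_nth)

lemma weight_fps_cpsm_power_nth: "(weight_fps (cpsm_weight \<alpha> z) ^ k) $ n = z ^ k * (gfc_fps \<alpha> ^ k) $ n"
  by (simp add: weight_fps_cpsm power_mult_distrib fps_const_power)

lemma gibbs_sum_cpsm: "gibbs_sum (cpsm_weight \<alpha> z) n = (\<Sum>k\<le>n. z ^ k / fact k * (gfc_fps \<alpha> ^ k) $ n)"
  by (simp add: gibbs_sum_blocks weight_fps_cpsm_power_nth)

text \<open>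
  This identifies the normalising constant in \<^const>\<open>nb_cpsm_prob\<close>.
\<close>

lemma gibbs_sum_cpsm_gen_fact_coeff:
  "gibbs_sum (cpsm_weight \<alpha> z) n = (\<Sum>j\<le>n. gen_fact_coeff n j \<alpha> * z ^ j) / fact n"
  by (simp add: gibbs_sum_cpsm gen_fact_coeff_eq sum_divide_distrib mult_ac)

lemma nb_cpsm_gibbs_law:
  assumes law: "nb_cpsm \<alpha> z n \<Omega> M"
  shows "gibbs_law (cpsm_weight \<alpha> z) n \<Omega> M"
proof -
  have "nb_cpsm_prob \<alpha> z n x = gibbs_weight (cpsm_weight \<alpha> z) n x / gibbs_sum (cpsm_weight \<alpha> z) n"
    if "x \<in> part_types n n" for x
    using that
    by (simp add: nb_cpsm_prob_def part_types_def gibbs_weight_def gibbs_sum_cpsm_gen_fact_coeff cpsm_weight_def)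
  with law show ?thesis by (auto simp: nb_cpsm_def gibbs_law_def)
qed

text \<open>
  The condition \<open>\<alpha> * z > 0\<close> holds in both parameter ranges of the model.
\<close>

lemma cpsm_weight_pos:
  assumes "\<alpha> < 1" "\<alpha> * z > 0"
  shows "cpsm_weight \<alpha> z i > 0"
proof -
  have "cpsm_weight \<alpha> z i = (\<alpha> * z) * pochhammer (1 - \<alpha>) (i - 1) / fact i"
    by (simp add: cpsm_weight_def)
  then show ?thesis using assms by (simp add: pochhammer_pos)
qed

section \<open>Positive parameter: one big block\<close>

lemma gfc_fps_pos: "0 < \<alpha> \<Longrightarrow> \<alpha> < 1 \<Longrightarrow> n \<ge> 1 \<Longrightarrow> gfc_fps \<alpha> $ n > 0"
  by (simp add: gfc_fps_nth pochhammer_pos)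

lemma gfc_fps_nonneg: "0 < \<alpha> \<Longrightarrow> \<alpha> < 1 \<Longrightarrow> gfc_fps \<alpha> $ n \<ge> 0"
  using gfc_fps_pos[of \<alpha> n] by (cases "n = 0") (auto simp: gfc_fps_nth)

lemma fps_power_nonneg:
  fixes f :: "real fps"
  assumes "\<And>n. f $ n \<ge> 0"
  shows "(f ^ k) $ n \<ge> 0"
proof (induction k arbitrary: n)
  case (Suc k)
  then show ?case using assms by (auto simp: fps_mult_nth intro!: sum_nonneg)
qed (simp add: fps_one_nth)

text \<open>
  The factors satisfy \<open>\<bar>1 - 2 * \<alpha> + i\<bar> \<le> 1 - \<alpha> + i\<close> for \<open>i \<ge> 1\<close>. The factor of index 0 need not, but
  it is at most 1, whence the denominator \<open>1 - \<alpha>\<close>.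
\<close>

lemma abs_pochhammer_1_minus_twice_le:
  fixes \<alpha> :: real
  assumes "0 < \<alpha>" "\<alpha> < 1"
  shows "\<bar>pochhammer (1 - 2 * \<alpha>) n\<bar> \<le> pochhammer (1 - \<alpha>) n / (1 - \<alpha>)"
proof (induction n)
  case 0
  then show ?case using assms by (simp add: field_simps)
next
  case (Suc n)
  show ?case
  proof (cases "n = 0")
    case True
    then show ?thesis using assms by (auto simp: abs_if)
  next
    case False
    then have "\<bar>1 - 2 * \<alpha> + real n\<bar> \<le> 1 - \<alpha> + real n" using assms by (cases n) auto
    then have "\<bar>pochhammer (1 - 2 * \<alpha>) n\<bar> * \<bar>1 - 2 * \<alpha> + real n\<bar> \<le>
        pochhammer (1 - \<alpha>) n / (1 - \<alpha>) * (1 - \<alpha> + real n)"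
      using Suc by (intro mult_mono) auto
    then show ?thesis by (simp add: pochhammer_Suc abs_mult)
  qed
qed

text \<open>
  The square of \<open>1 - (1 - X)^\<alpha>\<close> is \<open>2 (1 - (1 - X)^\<alpha>) - (1 - (1 - X)^(2 \<alpha>))\<close>, and the coefficients of
  the last series are bounded in absolute value by multiples of those of \<open>1 - (1 - X)^\<alpha>\<close>. What matters
  is that the constant does not depend on \<open>n\<close>.
\<close>

lemma gfc_fps_square_le:
  assumes "0 < \<alpha>" "\<alpha> < 1"
  shows "(gfc_fps \<alpha> ^ 2) $ n \<le> (2 + 2 / (1 - \<alpha>)) * gfc_fps \<alpha> $ n"
proof (cases "n = 0")
  case True
  then show ?thesis by (simp add: gfc_fps_nth gfc_fps_power_nth_eq_0)
next
  case False
  have "gfc_fps \<alpha> ^ 2 = gfc_fps \<alpha> + gfc_fps \<alpha> - gfc_fps (2 * \<alpha>)"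
    using poch_fps_power[of "- \<alpha>" 2]
    by (simp add: gfc_fps_def power2_eq_square algebra_simps)
  then have "(gfc_fps \<alpha> ^ 2) $ n = 2 * gfc_fps \<alpha> $ n - 2 * \<alpha> * pochhammer (1 - 2 * \<alpha>) (n - 1) / fact n"
    using False by (simp add: gfc_fps_nth)
  also have "\<dots> \<le> 2 * gfc_fps \<alpha> $ n + 2 * \<alpha> * (pochhammer (1 - \<alpha>) (n - 1) / (1 - \<alpha>)) / fact n"
  proof -
    have "2 * \<alpha> * (- pochhammer (1 - 2 * \<alpha>) (n - 1)) / fact n \<le> 2 * \<alpha> * (pochhammer (1 - \<alpha>) (n - 1) / (1 - \<alpha>)) / fact n"
      using abs_pochhammer_1_minus_twice_le[OF assms, of "n - 1"] assms by (intro divide_right_mono mult_left_mono) auto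
    then show ?thesis by simp
  qed
  also have "\<dots> = (2 + 2 / (1 - \<alpha>)) * gfc_fps \<alpha> $ n"
    unfolding distrib_right using False by (simp add: gfc_fps_nth mult_ac)
  finally show ?thesis .
qed

text \<open>
  Every further convolution costs one factor of the constant for squares. Geometric growth in the
  exponent is harmless against the factor \<open>1 / fact k\<close> in the normalising sum.
\<close>

lemma gfc_fps_power_le:
  assumes "0 < \<alpha>" "\<alpha> < 1"
  shows "(gfc_fps \<alpha> ^ Suc k) $ n \<le> (2 + 2 / (1 - \<alpha>)) ^ k * gfc_fps \<alpha> $ n"
proof (induction k arbitrary: n)
  case 0
  then show ?case by simp
next
  case (Suc k)
  let ?B = "2 + 2 / (1 - \<alpha>)"
  have B: "?B \<ge> 0" using assms by simp
  have "(gfc_fps \<alpha> ^ Suc (Suc k)) $ n = (\<Sum>i=0..n. gfc_fps \<alpha> $ i * (gfc_fps \<alpha> ^ Suc k) $ (n - i))"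
    by (subst power_Suc) (rule fps_mult_nth)
  also have "\<dots> \<le> (\<Sum>i=0..n. gfc_fps \<alpha> $ i * (?B ^ k * gfc_fps \<alpha> $ (n - i)))"
    by (intro sum_mono mult_left_mono Suc gfc_fps_nonneg assms)
  also have "\<dots> = ?B ^ k * (gfc_fps \<alpha> ^ 2) $ n"
    by (simp add: power2_eq_square fps_mult_nth sum_distrib_left mult_ac)
  also have "\<dots> \<le> ?B ^ k * (?B * gfc_fps \<alpha> $ n)"
    using B by (intro mult_left_mono gfc_fps_square_le assms) auto
  finally show ?case by (simp add: mult_ac)
qed

text \<open>
  By Gauss's product for the Gamma function \<open>(x)_n\<close> is of the order \<open>n^x (n - 1)! / \<Gamma>(x)\<close>; \<open>b\<close> must not
  be a pole, or the denominator would vanish.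
\<close>

lemma pochhammer_ratio_tendsto_0:
  fixes a b :: real
  assumes "a < b" "b \<notin> \<int>\<^sub>\<le>\<^sub>0"
  shows "(\<lambda>n. pochhammer a n / pochhammer b n) \<longlonglongrightarrow> 0"
proof -
  have "(\<lambda>n. rGamma_series a n / rGamma_series b n * exp ((a - b) * ln (real n))) \<longlonglongrightarrow> rGamma a / rGamma b * 0"
  proof (intro tendsto_intros)
    show "rGamma b \<noteq> 0" using assms by (simp add: rGamma_eq_zero_iff)
    have "filterlim (\<lambda>n. (a - b) * ln (real n)) at_bot sequentially"
      using assms by (intro filterlim_tendsto_neg_mult_at_bot[OF tendsto_const] filterlim_compose[OF ln_at_top] filterlim_real_sequentially) auto
    then show "(\<lambda>n. exp ((a - b) * ln (real n))) \<longlonglongrightarrow> 0"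
      by (rule filterlim_compose[OF exp_at_bot])
  qed
  moreover have "rGamma_series a n / rGamma_series b n * exp ((a - b) * ln (real n)) =
      pochhammer a (Suc n) / pochhammer b (Suc n)" for n
    by (simp add: rGamma_series_def left_diff_distrib exp_diff)
  ultimately have "(\<lambda>n. pochhammer a (Suc n) / pochhammer b (Suc n)) \<longlonglongrightarrow> 0" by simp
  then show ?thesis by (rule LIMSEQ_imp_Suc)
qed

text \<open>
  The principle of a single big jump: \<open>k\<close> heavy-tailed summands add up to a large \<open>n\<close> because one of
  them, chosen in \<open>k\<close> ways, is close to \<open>n\<close>. Algebraically, in the binomial expansion of
  \<open>(1 - (1 - X)^\<alpha>)^k\<close> the constant contributes nothing, the powers \<open>(1 - X)^(i \<alpha>)\<close> with \<open>i \<ge> 2\<close> have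
  coefficients of smaller order than \<open>(1 - X)^\<alpha>\<close>, and \<open>i = 1\<close> occurs \<open>k\<close> times.
\<close>

lemma gfc_fps_power_asymp:
  assumes "0 < \<alpha>" "\<alpha> < 1"
  shows "(\<lambda>n. (gfc_fps \<alpha> ^ k) $ n / gfc_fps \<alpha> $ n) \<longlonglongrightarrow> real k"
proof -
  have nonint: "- \<alpha> \<notin> \<int>\<^sub>\<le>\<^sub>0"
  proof
    assume "- \<alpha> \<in> \<int>\<^sub>\<le>\<^sub>0"
    then obtain m where "\<alpha> = real m" by (elim nonpos_Ints_cases') simp
    with assms show False by simp
  qed
  have lim: "(\<lambda>n. pochhammer (- real i * \<alpha>) n / pochhammer (- \<alpha>) n) \<longlonglongrightarrow> of_bool (i = 1)" for i
  proof -
    consider "i = 0" | "i = 1" | "i > 1" by linarith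
    then show ?thesis
    proof cases
      case 1
      have "eventually (\<lambda>n. pochhammer (- real i * \<alpha>) n / pochhammer (- \<alpha>) n = 0) sequentially"
        using eventually_gt_at_top[of 0] by eventually_elim (simp add: 1 pochhammer_0_left)
      then show ?thesis using 1 by (simp add: tendsto_eventually)
    next
      case 2
      have "pochhammer (- \<alpha>) n \<noteq> 0" for n
        using nonint by (auto simp: pochhammer_eq_0_iff)
      then show ?thesis using 2 by simp
    next
      case 3
      then have "- real i * \<alpha> < - \<alpha>" using assms by simp
      then show ?thesis using pochhammer_ratio_tendsto_0[OF _ nonint] 3 by simp
    qed
  qed
  have "(\<lambda>n. \<Sum>i\<le>k. real (k choose i) * (-1) ^ Suc i * (pochhammer (- real i * \<alpha>) n / pochhammer (- \<alpha>) n))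
      \<longlonglongrightarrow> (\<Sum>i\<le>k. real (k choose i) * (-1) ^ Suc i * of_bool (i = 1))"
    by (intro tendsto_intros lim)
  also have "(\<Sum>i\<le>k. real (k choose i) * (-1) ^ Suc i * of_bool (i = 1)) = (\<Sum>i\<le>k. if i = 1 then real k else 0)"
    by (intro sum.cong) auto
  also have "\<dots> = real k" by (cases k) auto
  finally have main: "(\<lambda>n. \<Sum>i\<le>k. real (k choose i) * (-1) ^ Suc i * (pochhammer (- real i * \<alpha>) n / pochhammer (- \<alpha>) n))
      \<longlonglongrightarrow> real k" .
  have "eventually (\<lambda>n. (\<Sum>i\<le>k. real (k choose i) * (-1) ^ Suc i * (pochhammer (- real i * \<alpha>) n / pochhammer (- \<alpha>) n)) =
      (gfc_fps \<alpha> ^ k) $ n / gfc_fps \<alpha> $ n) sequentially"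
    using eventually_gt_at_top[of 0]
  proof eventually_elim
    case (elim n)
    then have "gfc_fps \<alpha> $ n = - (pochhammer (- \<alpha>) n / fact n)"
      by (simp add: gfc_fps_def)
    then show ?case
      unfolding gfc_fps_power_nth by (simp add: sum_divide_distrib sum_distrib_right sum_negf)
  qed
  with main show ?thesis by (rule Lim_transform_eventually)
qed

lemma exp_index_sums: "(\<lambda>k. z ^ k / fact k * real k) sums (z * exp (z :: real))"
proof -
  have "(\<lambda>k. z * (z ^ k / fact k)) sums (z * exp z)"
    using exp_converges[of z] by (intro sums_mult) (simp add: divide_inverse mult_ac)
  moreover have "z * (z ^ k / fact k) = z ^ Suc k / fact (Suc k) * real (Suc k)" for k
    by (simp add: field_simps del: of_nat_Suc)
  ultimately have "(\<lambda>k. z ^ Suc k / fact (Suc k) * real (Suc k)) sums (z * exp z)" by simp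
  then show ?thesis by (subst (asm) sums_Suc_iff) simp
qed

text \<open>
  Sum the previous asymptotics against \<open>z ^ k / fact k\<close>, with the geometric bound for
  \<^const>\<open>gfc_fps\<close> as majorant in Tannery's theorem.
\<close>

lemma gibbs_sum_cpsm_asymp:
  assumes "0 < \<alpha>" "\<alpha> < 1" "z > 0"
  shows "(\<lambda>n. gibbs_sum (cpsm_weight \<alpha> z) n / gfc_fps \<alpha> $ n) \<longlonglongrightarrow> z * exp z"
proof -
  define B where "B = 2 + 2 / (1 - \<alpha>)"
  let ?a = "\<lambda>k n. z ^ k / fact k * ((gfc_fps \<alpha> ^ k) $ n / gfc_fps \<alpha> $ n)"
  let ?M = "\<lambda>k. (z * B) ^ k / fact k"
  have B: "B \<ge> 1" using assms by (simp add: B_def)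
  have "eventually (\<lambda>n. summable (\<lambda>k. norm (?a k n))) sequentially \<and>
      summable (\<lambda>k. norm (z ^ k / fact k * real k)) \<and> ((\<lambda>n. \<Sum>k. ?a k n) \<longlonglongrightarrow> (\<Sum>k. z ^ k / fact k * real k))"
  proof (rule tannerys_theorem)
    show "(\<lambda>n. ?a k n) \<longlonglongrightarrow> z ^ k / fact k * real k" for k
      by (intro tendsto_intros gfc_fps_power_asymp assms)
  next
    have "norm (?a k n) \<le> ?M k" if n: "n \<ge> 1" for k n
    proof -
      have pos: "gfc_fps \<alpha> $ n > 0" using gfc_fps_pos assms n by simp
      have "(gfc_fps \<alpha> ^ k) $ n / gfc_fps \<alpha> $ n \<le> B ^ k"
      proof (cases k)
        case 0
        then show ?thesis using n by (simp add: fps_one_nth)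
      next
        case (Suc j)
        have "(gfc_fps \<alpha> ^ k) $ n / gfc_fps \<alpha> $ n \<le> B ^ j"
          using gfc_fps_power_le[OF assms(1,2), of j n] pos by (simp add: Suc B_def divide_le_eq)
        also have "B ^ j \<le> B ^ k" using B Suc by (intro power_increasing) auto
        finally show ?thesis .
      qed
      then have "?a k n \<le> z ^ k / fact k * B ^ k"
        using assms by (intro mult_left_mono) auto
      moreover have "?a k n \<ge> 0"
        using assms pos fps_power_nonneg[of "gfc_fps \<alpha>" k n] gfc_fps_nonneg by auto
      ultimately show ?thesis by (simp add: power_mult_distrib)
    qed
    then show "eventually (\<lambda>(k, n). norm (?a k n) \<le> ?M k) (at_top \<times>\<^sub>F sequentially)"
      unfolding eventually_prod_filter
      by (intro exI[of _ "\<lambda>_. True"] exI[of _ "\<lambda>n. n \<ge> 1"]) (auto intro: eventually_ge_at_top)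
  next
    show "summable ?M"
      using summable_exp_generic[of "z * B"] by (simp add: divide_inverse mult_ac)
  qed simp
  then have "(\<lambda>n. \<Sum>k. ?a k n) \<longlonglongrightarrow> z * exp z"
    using sums_unique[OF exp_index_sums[of z]] by simp
  moreover have "(\<Sum>k. ?a k n) = gibbs_sum (cpsm_weight \<alpha> z) n / gfc_fps \<alpha> $ n" for n
  proof -
    have "(\<Sum>k. ?a k n) = (\<Sum>k\<le>n. ?a k n)"
      by (rule suminf_finite) (auto simp: gfc_fps_power_nth_eq_0)
    then show ?thesis by (simp add: gibbs_sum_cpsm sum_divide_distrib)
  qed
  ultimately show ?thesis by simp
qed

text \<open>
  Inherited from the coefficients of \<open>1 - (1 - X)^\<alpha>\<close>, whose successive quotients are explicit.
\<close>

lemma gibbs_sum_cpsm_ratio_tendsto_1_pos: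
  assumes "0 < \<alpha>" "\<alpha> < 1" "z > 0"
  shows "(\<lambda>n. gibbs_sum (cpsm_weight \<alpha> z) n / gibbs_sum (cpsm_weight \<alpha> z) (Suc n)) \<longlonglongrightarrow> 1"
proof -
  let ?c = "gibbs_sum (cpsm_weight \<alpha> z)" and ?f = "\<lambda>n. gfc_fps \<alpha> $ n"
  have "(\<lambda>n. (real n + 1) / (real n - \<alpha>)) \<longlonglongrightarrow> 1" by real_asymp
  then have "(\<lambda>n. (?c n / ?f n) / (?c (Suc n) / ?f (Suc n)) * ((real n + 1) / (real n - \<alpha>))) \<longlonglongrightarrow> (z * exp z) / (z * exp z) * 1"
    using assms by (intro tendsto_intros gibbs_sum_cpsm_asymp LIMSEQ_Suc[OF gibbs_sum_cpsm_asymp]) auto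
  moreover have "eventually (\<lambda>n. (?c n / ?f n) / (?c (Suc n) / ?f (Suc n)) * ((real n + 1) / (real n - \<alpha>)) = ?c n / ?c (Suc n)) sequentially"
    using eventually_ge_at_top[of 1]
  proof eventually_elim
    case (elim n)
    have pos: "?f n > 0" "?f (Suc n) > 0" using elim assms gfc_fps_pos by auto
    have "?f (Suc n) * (real n + 1) = ?f n * (real n - \<alpha>)"
    proof -
      have "pochhammer (1 - \<alpha>) n = pochhammer (1 - \<alpha>) (n - 1) * (real n - \<alpha>)"
        using elim by (cases n) (auto simp: pochhammer_Suc algebra_simps)
      moreover have "fact (Suc n) = (real n + 1) * fact n" by simp
      ultimately show ?thesis
        using elim by (simp add: gfc_fps_nth del: fact_Suc)
    qed
    moreover have "real n - \<alpha> > 0" using elim assms by linarith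
    ultimately have "?f (Suc n) / ?f n * ((real n + 1) / (real n - \<alpha>)) = 1"
      using pos by (simp add: field_simps)
    moreover have "(?c n / ?f n) / (?c (Suc n) / ?f (Suc n)) * ((real n + 1) / (real n - \<alpha>)) =
        ?c n / ?c (Suc n) * (?f (Suc n) / ?f n * ((real n + 1) / (real n - \<alpha>)))"
      by (simp add: mult_ac)
    ultimately show ?case by (simp only: mult_1_right)
  qed
  ultimately show ?thesis using assms by (auto intro: Lim_transform_eventually)
qed

text \<open>
  The probability of \<open>k\<close> blocks tends to \<open>(z ^ k / fact k) * k / (z * exp z)\<close>. The factor \<open>k\<close>, from the
  choice of the big block, cancels against the factorial and shifts the Poisson law by 1.
\<close>

lemma blocks_weak_limit_pos:
  assumes law: "\<And>n. n \<ge> 1 \<Longrightarrow> gibbs_law (cpsm_weight \<alpha> z) n (\<Omega> n) (M n)"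
    and \<alpha>: "0 < \<alpha>" "\<alpha> < 1" and z: "z > 0"
  shows "weak_conv_m (\<lambda>n. distr (\<Omega> n) borel (\<lambda>\<omega>. real (\<Sum>r=1..n. M n r \<omega>)))
           (distr (measure_pmf (poisson_pmf z)) borel (\<lambda>k. 1 + real k))"
proof -
  let ?w = "cpsm_weight \<alpha> z" and ?P = "measure_pmf (poisson_pmf z)"
  have pos: "gibbs_sum ?w n > 0" for n
    using \<alpha> z by (intro gibbs_sum_pos cpsm_weight_pos) auto
  have "weak_conv_m (\<lambda>n. distr (\<Omega> n) borel (\<lambda>\<omega>. real (\<Sum>r=1..n. M n r \<omega>)))
      (distr ?P borel (\<lambda>k. real (Suc k)))"
  proof (rule weak_conv_m_nat)
    show "eventually (\<lambda>n. prob_space (\<Omega> n) \<and>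
        (\<lambda>\<omega>. \<Sum>r=1..n. M n r \<omega>) \<in> measurable (\<Omega> n) (count_space UNIV)) sequentially"
      using eventually_ge_at_top[of 1]
      by eventually_elim (use gibbs_law_measurable[OF law] in auto)
    show "prob_space ?P" by (rule prob_space_measure_pmf)
    fix k
    have "(\<lambda>n. z ^ k / fact k * ((gfc_fps \<alpha> ^ k) $ n / gfc_fps \<alpha> $ n) / (gibbs_sum ?w n / gfc_fps \<alpha> $ n))
        \<longlonglongrightarrow> z ^ k / fact k * real k / (z * exp z)"
      using z by (intro tendsto_intros gfc_fps_power_asymp gibbs_sum_cpsm_asymp \<alpha>) auto
    moreover have "eventually (\<lambda>n. z ^ k / fact k * ((gfc_fps \<alpha> ^ k) $ n / gfc_fps \<alpha> $ n) / (gibbs_sum ?w n / gfc_fps \<alpha> $ n) =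
        measure (\<Omega> n) {\<omega> \<in> space (\<Omega> n). (\<Sum>r=1..n. M n r \<omega>) = k}) sequentially"
      using eventually_ge_at_top[of "max 1 k"]
    proof eventually_elim
      case (elim n)
      then have "{j. j \<le> n \<and> j = k} = {k}" by auto
      then have "measure (\<Omega> n) {\<omega> \<in> space (\<Omega> n). (\<Sum>r=1..n. M n r \<omega>) = k} =
          z ^ k * (gfc_fps \<alpha> ^ k) $ n / fact k / gibbs_sum ?w n"
        using gibbs_law_blocks[OF law pos, of n "\<lambda>j. j = k"] elim
        by (simp add: weight_fps_cpsm_power_nth)
      moreover have "gfc_fps \<alpha> $ n > 0" using elim \<alpha> by (intro gfc_fps_pos) auto
      ultimately show ?case by simp
    qed
    ultimately have "(\<lambda>n. measure (\<Omega> n) {\<omega> \<in> space (\<Omega> n). (\<Sum>r=1..n. M n r \<omega>) = k})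
        \<longlonglongrightarrow> z ^ k / fact k * real k / (z * exp z)"
      by (rule Lim_transform_eventually)
    also have "z ^ k / fact k * real k / (z * exp z) = measure ?P {j \<in> space ?P. Suc j = k}"
    proof (cases k)
      case 0
      then show ?thesis by simp
    next
      case (Suc j)
      have "{i \<in> space ?P. Suc i = k} = {i \<in> space ?P. i = j}" using Suc by auto
      then have "measure ?P {i \<in> space ?P. Suc i = k} = z ^ j / fact j * exp (- z)"
        using z by (simp only: measure_poisson_single)
      moreover have "z ^ k / fact k * real k = z * (z ^ j / fact j)"
        unfolding Suc by (simp add: field_simps del: of_nat_Suc)
      ultimately show ?thesis using z by (simp add: exp_minus divide_inverse)
    qed
    finally show "(\<lambda>n. measure (\<Omega> n) {\<omega> \<in> space (\<Omega> n). (\<Sum>r=1..n. M n r \<omega>) = k})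
        \<longlonglongrightarrow> measure ?P {j \<in> space ?P. Suc j = k}" .
  qed simp
  then show ?thesis by simp
qed

section \<open>Negative parameter: a formula of Dobinski type\<close>

lemma binomial_exp_sums:
  "(\<lambda>k. x ^ k / fact k * real (k choose j)) sums (x ^ j / fact j * exp (x :: real))"
proof -
  have "(\<lambda>k. x ^ j / fact j * (x ^ k / fact k)) sums (x ^ j / fact j * exp x)"
    using exp_converges[of x] by (intro sums_mult) (simp add: divide_inverse mult_ac)
  moreover have "x ^ j / fact j * (x ^ k / fact k) = x ^ (k + j) / fact (k + j) * real ((k + j) choose j)" for k
    by (simp add: binomial_fact power_add)
  ultimately have "(\<lambda>k. x ^ (k + j) / fact (k + j) * real ((k + j) choose j)) sums (x ^ j / fact j * exp x)"
    by simp
  then show ?thesis by (subst (asm) sums_zero_iff_shift) (auto simp: binomial_eq_0)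
qed

text \<open>
  The inverse of the expansion of powers of \<^const>\<open>gfc_fps\<close>: \<open>(1 - X)^(k \<alpha>)\<close> is expanded as a power
  of \<open>1 - (1 - (1 - X)^\<alpha>)\<close>. The sum is cut at \<open>n\<close>, not at \<open>k\<close>, so that it can be interchanged with a
  series in \<open>k\<close>.
\<close>

lemma pochhammer_binomial_gfc:
  "pochhammer (- real k * \<alpha>) n / fact n = (\<Sum>j\<le>n. real (k choose j) * (-1) ^ j * (gfc_fps \<alpha> ^ j) $ n)"
proof -
  have "poch_fps (- real k * \<alpha>) = (- gfc_fps \<alpha> + 1) ^ k"
    using poch_fps_power[of "- \<alpha>" k] by (simp add: gfc_fps_def)
  also have "\<dots> = (\<Sum>j\<le>k. of_nat (k choose j) * (- gfc_fps \<alpha>) ^ j * 1 ^ (k - j))"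
    by (rule binomial_ring)
  also have "\<dots> = (\<Sum>j\<le>k. fps_const (real (k choose j) * (-1) ^ j) * gfc_fps \<alpha> ^ j)"
  proof (intro sum.cong refl)
    fix j
    have "(- gfc_fps \<alpha>) ^ j = fps_const ((-1) ^ j) * gfc_fps \<alpha> ^ j"
      by (subst power_minus)
        (simp add: fps_const_power[symmetric] fps_const_neg[symmetric] del: fps_const_power fps_const_neg)
    then show "of_nat (k choose j) * (- gfc_fps \<alpha>) ^ j * 1 ^ (k - j) =
        fps_const (real (k choose j) * (-1) ^ j) * gfc_fps \<alpha> ^ j"
      by (simp only: fps_of_nat[symmetric] fps_const_mult[symmetric] mult.assoc power_one mult_1_right)
  qed
  finally have "poch_fps (- real k * \<alpha>) $ n = (\<Sum>j\<le>k. real (k choose j) * (-1) ^ j * (gfc_fps \<alpha> ^ j) $ n)"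
    by (simp add: fps_sum_nth)
  also have "\<dots> = (\<Sum>j\<le>max k n. real (k choose j) * (-1) ^ j * (gfc_fps \<alpha> ^ j) $ n)"
    by (rule sum.mono_neutral_left) (auto simp: binomial_eq_0)
  also have "\<dots> = (\<Sum>j\<le>n. real (k choose j) * (-1) ^ j * (gfc_fps \<alpha> ^ j) $ n)"
    by (rule sum.mono_neutral_right) (auto simp: gfc_fps_power_nth_eq_0)
  finally show ?thesis by simp
qed

definition dobinski_term :: "real \<Rightarrow> real \<Rightarrow> nat \<Rightarrow> nat \<Rightarrow> real" where
  "dobinski_term a y n k = y ^ k / fact k * pochhammer (real k * a) n"

text \<open>
  Both sides are \<open>fact n\<close> times the coefficient of \<open>X^n\<close> in \<open>exp (y (1 - X)^(- a))\<close>: on the left the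
  exponential is expanded in powers of \<open>y (1 - X)^(- a)\<close>, on the right it is
  \<open>exp y * exp (y ((1 - X)^(- a) - 1))\<close>. This is the analogue of Dobinski's
  formula for the Bell numbers; for positive \<open>a\<close> and \<open>y\<close> all terms are nonnegative.
\<close>

lemma dobinski_term_sums:
  "dobinski_term a y n sums (fact n * exp y * gibbs_sum (cpsm_weight (- a) (- y)) n)"
proof -
  have "(\<lambda>k. \<Sum>j\<le>n. (-1) ^ j * (gfc_fps (- a) ^ j) $ n * (y ^ k / fact k * real (k choose j))) sums
      (\<Sum>j\<le>n. (-1) ^ j * (gfc_fps (- a) ^ j) $ n * (y ^ j / fact j * exp y))"
    by (intro sums_sum sums_mult binomial_exp_sums)
  moreover have "(\<Sum>j\<le>n. (-1) ^ j * (gfc_fps (- a) ^ j) $ n * (y ^ k / fact k * real (k choose j))) =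
      dobinski_term a y n k / fact n" for k
  proof -
    have "(\<Sum>j\<le>n. (-1) ^ j * (gfc_fps (- a) ^ j) $ n * (y ^ k / fact k * real (k choose j))) =
        y ^ k / fact k * (\<Sum>j\<le>n. real (k choose j) * (-1) ^ j * (gfc_fps (- a) ^ j) $ n)"
      unfolding sum_distrib_left by (intro sum.cong refl) (simp only: mult_ac)
    also have "\<dots> = dobinski_term a y n k / fact n"
      unfolding pochhammer_binomial_gfc[of k "- a" n, symmetric] by (simp add: dobinski_term_def)
    finally show ?thesis .
  qed
  moreover have "(\<Sum>j\<le>n. (-1) ^ j * (gfc_fps (- a) ^ j) $ n * (y ^ j / fact j * exp y)) =
      exp y * gibbs_sum (cpsm_weight (- a) (- y)) n"
    unfolding gibbs_sum_cpsm sum_distrib_left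
  proof (intro sum.cong refl)
    fix j
    have "(- y) ^ j = (-1) ^ j * y ^ j" by (rule power_minus)
    then show "(-1) ^ j * (gfc_fps (- a) ^ j) $ n * (y ^ j / fact j * exp y) =
        exp y * ((- y) ^ j / fact j * (gfc_fps (- a) ^ j) $ n)"
      by (simp only: mult_ac times_divide_eq_right)
  qed
  ultimately have "(\<lambda>k. dobinski_term a y n k / fact n) sums (exp y * gibbs_sum (cpsm_weight (- a) (- y)) n)"
    by simp
  from sums_mult[OF this, of "fact n"] show ?thesis by (simp add: mult_ac)
qed

definition block_scale :: "real \<Rightarrow> nat \<Rightarrow> real" where
  "block_scale a n = real n powr (a / (1 + a))"

text \<open>
  The value of \<open>s\<close> for which the quotient of consecutive terms at the index \<open>s * block_scale a n\<close>
  tends to 1, so that the terms are largest there.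
\<close>

definition block_const :: "real \<Rightarrow> real \<Rightarrow> real" where
  "block_const a y = (a * y) powr (1 / (1 + a)) / a"

context
  fixes a y :: real
  assumes a: "a > 0" and y: "y > 0"
begin

lemma dobinski_term_nonneg: "dobinski_term a y n k \<ge> 0"
proof -
  have "pochhammer (real k * a) n \<ge> 0"
    using a by (cases "k = 0") (auto simp: pochhammer_0_left intro!: pochhammer_nonneg)
  then show ?thesis using y by (simp add: dobinski_term_def)
qed

lemma dobinski_term_0: "n \<ge> 1 \<Longrightarrow> dobinski_term a y n 0 = 0"
  by (simp add: dobinski_term_def pochhammer_0_left)

lemma dobinski_term_Suc_left: "dobinski_term a y (Suc n) k = dobinski_term a y n k * (real k * a + real n)"
  by (simp add: dobinski_term_def pochhammer_Suc)

lemma dobinski_term_Suc_right: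
  "dobinski_term a y n (Suc k) = y / (real k + 1) * (y ^ k / fact k * pochhammer (real k * a + a) n)"
  by (simp add: dobinski_term_def algebra_simps)

lemma cpsm_sum_pos: "gibbs_sum (cpsm_weight (- a) (- y)) n > 0"
  using a y by (intro gibbs_sum_pos cpsm_weight_pos) auto

lemma suminf_dobinski_term: "suminf (dobinski_term a y n) = fact n * exp y * gibbs_sum (cpsm_weight (- a) (- y)) n"
  using dobinski_term_sums by (rule sums_unique[symmetric])

lemma summable_dobinski_term: "summable (dobinski_term a y n)"
  using dobinski_term_sums by (rule sums_summable)

lemma suminf_dobinski_term_pos: "suminf (dobinski_term a y n) > 0"
  using cpsm_sum_pos by (simp add: suminf_dobinski_term)

text \<open>
  Crude, but bounded while \<open>x\<close> is at least of the order of \<open>n\<close>; that is the range in which it is applied.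
\<close>

lemma pochhammer_add_le_exp:
  assumes "x > 0"
  shows "pochhammer (x + a) n \<le> exp (real n * a / x) * pochhammer x n"
proof -
  have "pochhammer (x + a) n \<le> (1 + a / x) ^ n * pochhammer x n"
  proof (induction n)
    case (Suc n)
    have "x + a + real n \<le> (1 + a / x) * (x + real n)"
      using assms a by (simp add: field_simps)
    then have "pochhammer (x + a) n * (x + a + real n) \<le> (1 + a / x) ^ n * pochhammer x n * ((1 + a / x) * (x + real n))"
      using Suc assms a by (intro mult_mono) (auto intro!: mult_nonneg_nonneg pochhammer_nonneg)
    then show ?case by (simp add: pochhammer_Suc mult_ac)
  qed simp
  also have "(1 + a / x) ^ n \<le> exp (a / x) ^ n"
    using assms a by (intro power_mono exp_ge_add_one_self) auto
  also have "exp (a / x) ^ n = exp (real n * a / x)"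
    by (simp add: exp_of_nat_mult[symmetric])
  finally show ?thesis using assms by (simp add: pochhammer_nonneg mult_right_mono)
qed

lemma dobinski_sum_Suc_ge: "real n * suminf (dobinski_term a y n) \<le> suminf (dobinski_term a y (Suc n))"
proof -
  have "real n * suminf (dobinski_term a y n) = (\<Sum>k. real n * dobinski_term a y n k)"
    by (rule suminf_mult[OF summable_dobinski_term, symmetric])
  also have "\<dots> \<le> suminf (dobinski_term a y (Suc n))"
  proof (rule suminf_le)
    fix k
    show "real n * dobinski_term a y n k \<le> dobinski_term a y (Suc n) k"
      using dobinski_term_nonneg[of n k] a by (simp add: dobinski_term_Suc_left algebra_simps)
  qed (intro summable_mult summable_dobinski_term)+
  finally show ?thesis .
qed

text \<open>
  Passing from \<open>n\<close> to \<open>n + 1\<close> multiplies the \<open>k\<close>-th term by \<open>k * a + n\<close>, so the quotient of the sums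
  is \<open>n\<close> plus \<open>a\<close> times the mean index under the weights given by the terms. This bounds the mean index:
  indices up to \<open>\<epsilon> * n + 1\<close> contribute at most that much, and beyond them
  \<open>(k + 1) * dobinski_term a y n (k + 1)\<close> is at most \<open>y * exp (1 / \<epsilon>)\<close> times the preceding term.
\<close>

lemma dobinski_sum_Suc_le:
  assumes "n \<ge> 1" "\<epsilon> > 0"
  shows "suminf (dobinski_term a y (Suc n)) \<le>
    (real n + a * (\<epsilon> * real n + 1) + a * y * exp (1 / \<epsilon>)) * suminf (dobinski_term a y n)"
proof -
  let ?P = "a * (\<epsilon> * real n + 1) + real n" and ?Q = "a * y * exp (1 / \<epsilon>)"
  have shift: "suminf (dobinski_term a y m) = (\<Sum>k. dobinski_term a y m (Suc k))" if "m \<ge> 1" for m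
    using suminf_split_head[OF summable_dobinski_term, of m] dobinski_term_0[OF that] by simp
  have step: "dobinski_term a y (Suc n) (Suc k) \<le> ?P * dobinski_term a y n (Suc k) + ?Q * dobinski_term a y n k" for k
  proof -
    have "(real k + 1) * dobinski_term a y n (Suc k) \<le> (\<epsilon> * real n + 1) * dobinski_term a y n (Suc k) + y * exp (1 / \<epsilon>) * dobinski_term a y n k"
    proof (cases "real k \<le> \<epsilon> * real n")
      case True
      then have "(real k + 1) * dobinski_term a y n (Suc k) \<le> (\<epsilon> * real n + 1) * dobinski_term a y n (Suc k)"
        by (intro mult_right_mono dobinski_term_nonneg) auto
      moreover have "y * exp (1 / \<epsilon>) * dobinski_term a y n k \<ge> 0"
        using y dobinski_term_nonneg by simp
      ultimately show ?thesis by linarith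
    next
      case False
      then have k: "real k > 0" using assms by (smt (verit) mult_nonneg_nonneg of_nat_0_le_iff)
      have "real n * a / (real k * a) \<le> 1 / \<epsilon>"
        using False k a assms by (simp add: field_simps)
      then have "pochhammer (real k * a + a) n \<le> exp (1 / \<epsilon>) * pochhammer (real k * a) n"
        using pochhammer_add_le_exp[of "real k * a" n] k a
        by (smt (verit) exp_le_cancel_iff mult_pos_pos mult_right_mono pochhammer_nonneg)
      then have "y ^ k / fact k * pochhammer (real k * a + a) n \<le> y ^ k / fact k * (exp (1 / \<epsilon>) * pochhammer (real k * a) n)"
        using y by (intro mult_left_mono) auto
      also have "\<dots> = exp (1 / \<epsilon>) * dobinski_term a y n k" by (simp add: dobinski_term_def)
      finally have "y * (y ^ k / fact k * pochhammer (real k * a + a) n) \<le> y * (exp (1 / \<epsilon>) * dobinski_term a y n k)"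
        using y by (intro mult_left_mono) auto
      moreover have "(real k + 1) * dobinski_term a y n (Suc k) = y * (y ^ k / fact k * pochhammer (real k * a + a) n)"
        by (simp add: dobinski_term_Suc_right)
      moreover have "(\<epsilon> * real n + 1) * dobinski_term a y n (Suc k) \<ge> 0"
        using assms dobinski_term_nonneg by simp
      ultimately show ?thesis by (simp add: mult_ac)
    qed
    then have "a * ((real k + 1) * dobinski_term a y n (Suc k)) \<le>
        a * ((\<epsilon> * real n + 1) * dobinski_term a y n (Suc k) + y * exp (1 / \<epsilon>) * dobinski_term a y n k)"
      using a by (intro mult_left_mono) auto
    then show ?thesis by (simp add: dobinski_term_Suc_left algebra_simps)
  qed
  have sm: "summable (\<lambda>k. dobinski_term a y m (Suc k))" for m
    using summable_dobinski_term by (simp add: summable_Suc_iff)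
  have "suminf (dobinski_term a y (Suc n)) = (\<Sum>k. dobinski_term a y (Suc n) (Suc k))"
    by (rule shift) simp
  also have "\<dots> \<le> (\<Sum>k. ?P * dobinski_term a y n (Suc k) + ?Q * dobinski_term a y n k)"
    by (intro suminf_le step sm summable_add summable_mult summable_dobinski_term)
  also have "\<dots> = ?P * (\<Sum>k. dobinski_term a y n (Suc k)) + ?Q * suminf (dobinski_term a y n)"
    by (simp add: suminf_add[symmetric] suminf_mult summable_mult sm summable_dobinski_term)
  also have "\<dots> = (?P + ?Q) * suminf (dobinski_term a y n)"
    by (simp only: shift[OF assms(1), symmetric] distrib_right)
  finally show ?thesis by (simp add: add_ac)
qed

text \<open>
  The mean index is \<open>o(n)\<close>, so passing from \<open>n\<close> to \<open>n + 1\<close> multiplies the sum of the series by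
  \<open>n + o(n)\<close>. The normalising sums are these sums divided by \<open>fact n * exp y\<close>.
\<close>

lemma gibbs_sum_cpsm_ratio_tendsto_1_neg:
  "(\<lambda>n. gibbs_sum (cpsm_weight (- a) (- y)) n / gibbs_sum (cpsm_weight (- a) (- y)) (Suc n)) \<longlonglongrightarrow> 1"
proof -
  let ?c = "gibbs_sum (cpsm_weight (- a) (- y))"
  have T: "suminf (dobinski_term a y (Suc n)) / suminf (dobinski_term a y n) = (real n + 1) * (?c (Suc n) / ?c n)" for n
    by (simp add: suminf_dobinski_term)
  have lower: "real n / (real n + 1) \<le> ?c (Suc n) / ?c n" for n
  proof -
    have "real n \<le> (real n + 1) * (?c (Suc n) / ?c n)"
      unfolding T[symmetric] using dobinski_sum_Suc_ge[of n] suminf_dobinski_term_pos[of n]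
      by (simp add: le_divide_eq)
    then show ?thesis by (simp add: divide_le_eq mult_ac)
  qed
  have upper: "?c (Suc n) / ?c n \<le> (real n + a * (\<epsilon> * real n + 1) + a * y * exp (1 / \<epsilon>)) / (real n + 1)"
    if "n \<ge> 1" "\<epsilon> > 0" for n \<epsilon>
  proof -
    have "(real n + 1) * (?c (Suc n) / ?c n) \<le> real n + a * (\<epsilon> * real n + 1) + a * y * exp (1 / \<epsilon>)"
      unfolding T[symmetric] using dobinski_sum_Suc_le[OF that] suminf_dobinski_term_pos[of n]
      by (simp add: divide_le_eq)
    then show ?thesis by (simp add: le_divide_eq mult_ac)
  qed
  have "(\<lambda>n. ?c (Suc n) / ?c n) \<longlonglongrightarrow> 1"
  proof (rule order_tendstoI)
    fix l :: real assume l: "l < 1"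
    have "(\<lambda>n. real n / (real n + 1)) \<longlonglongrightarrow> 1" by real_asymp
    then have "eventually (\<lambda>n. real n / (real n + 1) > l) sequentially"
      using l by (rule order_tendstoD)
    then show "eventually (\<lambda>n. ?c (Suc n) / ?c n > l) sequentially"
      by eventually_elim (use lower in \<open>blast intro: less_le_trans\<close>)
  next
    fix u :: real assume u: "1 < u"
    \<comment> \<open>chosen so that the upper bound tends to \<open>1 + a * \<epsilon>\<close>, the midpoint of 1 and \<open>u\<close>\<close>
    define \<epsilon> where "\<epsilon> = (u - 1) / (2 * a)"
    have eps: "\<epsilon> > 0" using u a by (simp add: \<epsilon>_def)
    define C where "C = a + a * y * exp (1 / \<epsilon>)"
    have "(\<lambda>n. (1 + a * \<epsilon>) * (real n / (real n + 1)) + C * (1 / (real n + 1))) \<longlonglongrightarrow> (1 + a * \<epsilon>) * 1 + C * 0"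
      by (intro tendsto_intros; real_asymp)
    moreover have "(1 + a * \<epsilon>) * 1 + C * 0 < u" using u a by (simp add: \<epsilon>_def field_simps)
    ultimately have "eventually (\<lambda>n. (1 + a * \<epsilon>) * (real n / (real n + 1)) + C * (1 / (real n + 1)) < u) sequentially"
      by (rule order_tendstoD)
    then show "eventually (\<lambda>n. ?c (Suc n) / ?c n < u) sequentially"
      using eventually_ge_at_top[of 1]
    proof eventually_elim
      case (elim n)
      have "(1 + a * \<epsilon>) * (real n / (real n + 1)) + C * (1 / (real n + 1)) =
          (real n + a * (\<epsilon> * real n + 1) + a * y * exp (1 / \<epsilon>)) / (real n + 1)"
        by (simp add: C_def add_divide_distrib[symmetric] algebra_simps)
      with elim upper[OF elim(2) eps] show ?case by simp
    qed
  qed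
  then have "(\<lambda>n. 1 / (?c (Suc n) / ?c n)) \<longlonglongrightarrow> 1 / 1"
    by (intro tendsto_intros) auto
  then show ?thesis by simp
qed

section \<open>Negative parameter: concentration of the number of blocks\<close>

text \<open>
  Let \<open>G = (1 - X)^(- a) - 1\<close>, which has nonnegative coefficients. The coefficients of \<open>G^k\<close>, which give
  the law of the number of blocks, are at most those of \<open>(1 + G)^k\<close>, which give the series. So
  concentration of the series passes to the number of blocks, at the price of the constant \<open>exp y\<close>.
\<close>

lemma gibbs_law_blocks_le_dobinski:
  assumes law: "gibbs_law (cpsm_weight (- a) (- y)) n \<Omega> M"
  shows "measure \<Omega> {\<omega> \<in> space \<Omega>. Q (\<Sum>r=1..n. M r \<omega>)} \<le>
           exp y * (\<Sum>k | k \<le> n \<and> Q k. dobinski_term a y n k) / suminf (dobinski_term a y n)"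
proof -
  let ?c = "gibbs_sum (cpsm_weight (- a) (- y)) n" and ?w = "weight_fps (cpsm_weight (- a) (- y))"
  have "(?w ^ k) $ n / fact k \<le> dobinski_term a y n k / fact n" for k
  proof -
    define G where "G = poch_fps a - 1"
    have G: "(G ^ j) $ n \<ge> 0" for j n
      by (rule fps_power_nonneg) (use a in \<open>auto simp: G_def fps_one_nth intro!: divide_nonneg_pos pochhammer_nonneg\<close>)
    have "?w = fps_const y * G"
      by (rule fps_ext) (simp add: weight_fps_cpsm gfc_fps_def G_def algebra_simps)
    then have "(?w ^ k) $ n = y ^ k * (G ^ k) $ n"
      by (simp add: power_mult_distrib fps_const_power)
    moreover have "(G ^ k) $ n \<le> (poch_fps a ^ k) $ n"
    proof -
      have "poch_fps a ^ k = (\<Sum>j\<le>k. of_nat (k choose j) * G ^ j * 1 ^ (k - j))"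
        unfolding binomial_ring[symmetric] by (simp add: G_def)
      then have "(poch_fps a ^ k) $ n = (\<Sum>j\<le>k. real (k choose j) * (G ^ j) $ n)"
        by (simp add: fps_sum_nth fps_of_nat[symmetric] del: fps_of_nat)
      moreover have "real (k choose k) * (G ^ k) $ n \<le> (\<Sum>j\<le>k. real (k choose j) * (G ^ j) $ n)"
        by (rule member_le_sum) (auto intro!: mult_nonneg_nonneg G)
      ultimately show ?thesis by simp
    qed
    ultimately have "(?w ^ k) $ n / fact k \<le> y ^ k * (poch_fps a ^ k) $ n / fact k"
      using y by (simp add: divide_right_mono)
    then show ?thesis by (simp add: poch_fps_power dobinski_term_def mult_ac)
  qed
  then have "(\<Sum>k | k \<le> n \<and> Q k. (?w ^ k) $ n / fact k / ?c) \<le>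
      (\<Sum>k | k \<le> n \<and> Q k. dobinski_term a y n k / fact n / ?c)"
    using cpsm_sum_pos by (intro sum_mono divide_right_mono) (auto intro: less_imp_le)
  also have "\<dots> = exp y * (\<Sum>k | k \<le> n \<and> Q k. dobinski_term a y n k) / suminf (dobinski_term a y n)"
    by (simp add: suminf_dobinski_term sum_divide_distrib)
  finally show ?thesis
    unfolding gibbs_law_blocks[OF law cpsm_sum_pos] .
qed

text \<open>
  A set of indices carries a small share of the sum if each of its terms is a small multiple of a
  term at an index of its own.
\<close>

lemma dobinski_sum_le_shifted:
  assumes "finite F" "inj_on \<sigma> F" "c \<ge> 0"
    and "\<And>k. k \<in> F \<Longrightarrow> dobinski_term a y n k \<le> c * dobinski_term a y n (\<sigma> k)"
  shows "sum (dobinski_term a y n) F / suminf (dobinski_term a y n) \<le> c"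
proof -
  have "sum (dobinski_term a y n) F \<le> (\<Sum>k\<in>F. c * dobinski_term a y n (\<sigma> k))"
    by (intro sum_mono assms)
  also have "\<dots> = c * sum (dobinski_term a y n) (\<sigma> ` F)"
    using assms(2) by (simp add: sum_distrib_left sum.reindex)
  also have "\<dots> \<le> c * suminf (dobinski_term a y n)"
    using assms(1,3) by (intro mult_left_mono sum_le_suminf summable_dobinski_term) (auto simp: dobinski_term_nonneg)
  finally show ?thesis using suminf_dobinski_term_pos[of n] by (simp add: divide_le_eq)
qed

text \<open>
  The two elementary bounds below compare a factor \<open>1 + a / v\<close> of the quotient of ascending factorials
  \<open>(x + a)_n / (x)_n\<close> with the \<open>a\<close>-th power of a factor of a telescoping product. Both come from
  \<open>ln t \<le> t - 1\<close>.
\<close>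

lemma powr_upper_step: "v > 1 \<Longrightarrow> 1 + a / v \<le> (v / (v - 1)) powr a"
proof -
  assume v: "v > 1"
  have "1 / v \<le> ln (v / (v - 1))"
    using ln_le_minus_one[of "(v - 1) / v"] v by (simp add: ln_div field_simps)
  then have "a / v \<le> a * ln (v / (v - 1))"
    using a mult_left_mono[of "1 / v" "ln (v / (v - 1))" a] by simp
  then have "exp (a / v) \<le> (v / (v - 1)) powr a"
    using v by (simp add: powr_def)
  then show ?thesis using exp_ge_add_one_self[of "a / v"] by linarith
qed

lemma powr_lower_step: "v > 0 \<Longrightarrow> ((v + a + 1) / (v + a)) powr a \<le> 1 + a / v"
proof -
  assume v: "v > 0"
  have "ln ((v + a + 1) / (v + a)) \<le> 1 / (v + a)"
    using ln_le_minus_one[of "(v + a + 1) / (v + a)"] v a by (simp add: field_simps)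
  then have "a * ln ((v + a + 1) / (v + a)) \<le> a / (v + a)"
    using a mult_left_mono[of "ln ((v + a + 1) / (v + a))" "1 / (v + a)" a] by simp
  also have "\<dots> \<le> ln (1 + a / v)"
    using ln_le_minus_one[of "v / (v + a)"] v a by (simp add: ln_div field_simps add_divide_distrib[symmetric])
  finally have "exp (a * ln ((v + a + 1) / (v + a))) \<le> exp (ln (1 + a / v))" by simp
  then show ?thesis using v a by (simp add: powr_def add_pos_pos)
qed

text \<open>
  Together with its counterpart from below this shows that \<open>(x + a)_n / (x)_n\<close> behaves like \<open>(n / x)^a\<close>
  when \<open>x\<close> and \<open>n / x\<close> are both large.
\<close>

lemma pochhammer_add_le:
  assumes "x > 1"
  shows "pochhammer (x + a) n \<le> (1 + real n / (x - 1)) powr a * pochhammer x n"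
proof (induction n)
  case 0
  then show ?case using assms by simp
next
  case (Suc n)
  let ?v = "x + real n"
  have v: "?v > 1" using assms by linarith
  have "x + a + real n = (1 + a / ?v) * ?v" using v by (simp add: field_simps)
  also have "\<dots> \<le> (?v / (?v - 1)) powr a * ?v"
    using v by (intro mult_right_mono powr_upper_step) auto
  finally have "pochhammer (x + a) n * (x + a + real n) \<le>
      (1 + real n / (x - 1)) powr a * pochhammer x n * ((?v / (?v - 1)) powr a * ?v)"
    using Suc assms a by (intro mult_mono) (auto intro!: mult_nonneg_nonneg pochhammer_nonneg)
  also have "\<dots> = ((1 + real n / (x - 1)) * (?v / (?v - 1))) powr a * pochhammer x (Suc n)"
    using v assms by (subst powr_mult) (auto simp: pochhammer_Suc mult_ac)
  also have "(1 + real n / (x - 1)) * (?v / (?v - 1)) = 1 + real (Suc n) / (x - 1)"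
  proof -
    have "1 + real n / (x - 1) = (?v - 1) / (x - 1)" using assms by (simp add: field_simps)
    then have "(1 + real n / (x - 1)) * (?v / (?v - 1)) = ?v / (x - 1)" using v by simp
    also have "\<dots> = 1 + real (Suc n) / (x - 1)" using assms by (simp add: field_simps)
    finally show ?thesis .
  qed
  finally show ?case by (simp add: pochhammer_Suc)
qed

lemma pochhammer_add_ge:
  assumes "x > 0"
  shows "pochhammer (x + a) n \<ge> (1 + real n / (x + a)) powr a * pochhammer x n"
proof (induction n)
  case 0
  then show ?case using assms by simp
next
  case (Suc n)
  let ?v = "x + real n"
  have v: "?v > 0" using assms by linarith
  have "((?v + a + 1) / (?v + a)) powr a * ?v \<le> (1 + a / ?v) * ?v"
    using v by (intro mult_right_mono powr_lower_step) auto
  also have "\<dots> = x + a + real n" using v by (simp add: field_simps)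
  finally have "(1 + real n / (x + a)) powr a * pochhammer x n * (((?v + a + 1) / (?v + a)) powr a * ?v)
      \<le> pochhammer (x + a) n * (x + a + real n)"
    using Suc assms a v by (intro mult_mono) (auto intro!: mult_nonneg_nonneg pochhammer_nonneg)
  moreover have "(1 + real n / (x + a)) powr a * pochhammer x n * (((?v + a + 1) / (?v + a)) powr a * ?v) =
      ((1 + real n / (x + a)) * ((?v + a + 1) / (?v + a))) powr a * pochhammer x (Suc n)"
    using v assms a by (subst powr_mult) (auto simp: pochhammer_Suc mult_ac)
  moreover have "(1 + real n / (x + a)) * ((?v + a + 1) / (?v + a)) = 1 + real (Suc n) / (x + a)"
  proof -
    have "1 + real n / (x + a) = (?v + a) / (x + a)" using assms a by (simp add: field_simps)
    then have "(1 + real n / (x + a)) * ((?v + a + 1) / (?v + a)) = (?v + a + 1) / (x + a)" using v a by simp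
    also have "\<dots> = 1 + real (Suc n) / (x + a)" using assms a by (simp add: field_simps)
    finally show ?thesis .
  qed
  ultimately show ?case by (simp add: pochhammer_Suc)
qed

text \<open>
  The quotient of consecutive terms decreases in \<open>k\<close>, so one bound at \<open>x\<close> serves for all larger
  indices; in the lemma after this one, for all smaller ones.
\<close>

lemma dobinski_term_ratio_le:
  assumes "0 < x" "1 < a * x" "x \<le> real k"
  shows "dobinski_term a y n (Suc k) \<le> y / x * (1 + real n / (a * x - 1)) powr a * dobinski_term a y n k"
proof -
  have ka: "a * x \<le> real k * a" using assms a by (simp add: mult.commute)
  then have k: "1 < real k * a" using assms by linarith
  have "real n / (real k * a - 1) \<le> real n / (a * x - 1)"
    using assms ka k by (intro divide_left_mono mult_pos_pos) auto
  moreover have "real n / (real k * a - 1) \<ge> 0" using k by simp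
  ultimately have base: "(1 + real n / (real k * a - 1)) powr a \<le> (1 + real n / (a * x - 1)) powr a"
    using a by (intro powr_mono2) auto
  have "pochhammer (real k * a + a) n \<le> (1 + real n / (real k * a - 1)) powr a * pochhammer (real k * a) n"
    using assms ka by (intro pochhammer_add_le) auto
  also have "\<dots> \<le> (1 + real n / (a * x - 1)) powr a * pochhammer (real k * a) n"
    using k by (intro mult_right_mono base pochhammer_nonneg) auto
  finally have "y / (real k + 1) * (y ^ k / fact k * pochhammer (real k * a + a) n) \<le>
      y / x * (y ^ k / fact k * ((1 + real n / (a * x - 1)) powr a * pochhammer (real k * a) n))"
    using assms k a y
    by (intro mult_mono divide_left_mono mult_nonneg_nonneg pochhammer_nonneg) (auto intro: add_pos_pos)
  then show ?thesis unfolding dobinski_term_Suc_right by (simp add: dobinski_term_def mult_ac)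
qed

lemma dobinski_term_ratio_ge:
  assumes "1 \<le> k" "real k + 1 \<le> x"
  shows "y / x * (1 + real n / (a * x)) powr a * dobinski_term a y n k \<le> dobinski_term a y n (Suc k)"
proof -
  have x: "x > 0" using assms by linarith
  have ka: "real k * a + a \<le> a * x"
    using mult_left_mono[OF assms(2), of a] a by (simp add: algebra_simps)
  have k: "real k * a > 0" using assms a by simp
  have "(1 + real n / (a * x)) powr a * pochhammer (real k * a) n \<le>
      (1 + real n / (real k * a + a)) powr a * pochhammer (real k * a) n"
    using k ka a x
    by (intro mult_right_mono powr_mono2 add_left_mono divide_left_mono pochhammer_nonneg) auto
  also have "\<dots> \<le> pochhammer (real k * a + a) n"
    using k by (rule pochhammer_add_ge)
  finally have "y / x * (y ^ k / fact k * ((1 + real n / (a * x)) powr a * pochhammer (real k * a) n)) \<le>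
      y / (real k + 1) * (y ^ k / fact k * pochhammer (real k * a + a) n)"
    using assms k a y x
    by (intro mult_mono divide_left_mono mult_nonneg_nonneg pochhammer_nonneg) auto
  then show ?thesis unfolding dobinski_term_Suc_right by (simp add: dobinski_term_def mult_ac)
qed

lemma block_scale_at_top: "filterlim (block_scale a) at_top sequentially"
proof -
  have "filterlim (\<lambda>n. real n powr c) at_top sequentially" if "c > 0" for c
    using that by real_asymp
  then show ?thesis unfolding block_scale_def using a by simp
qed

lemma block_const_pos: "block_const a y > 0"
  using a y by (simp add: block_const_def)

lemma block_const_powr: "block_const a y powr (1 + a) = y / a powr a"
proof -
  have "block_const a y powr (1 + a) = a * y / a powr (1 + a)"
    using a y by (simp add: block_const_def powr_divide powr_powr)
  also have "a powr (1 + a) = a * a powr a"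
    using a by (simp add: powr_add)
  finally show ?thesis using a by simp
qed

lemma block_scale_over_n_tendsto_0: "(\<lambda>n. block_scale a n / real n) \<longlonglongrightarrow> 0"
proof -
  have "(\<lambda>n. real n powr (- (1 / (1 + a)))) \<longlonglongrightarrow> 0"
    using a by (intro tendsto_neg_powr filterlim_real_sequentially) auto
  moreover have "eventually (\<lambda>n. real n powr (- (1 / (1 + a))) = block_scale a n / real n) sequentially"
    using eventually_gt_at_top[of 0]
  proof eventually_elim
    case (elim n)
    have exponent: "a / (1 + a) = - (1 / (1 + a)) + 1" using a by (simp add: field_simps)
    have "block_scale a n = real n powr (- (1 / (1 + a))) * real n"
      unfolding block_scale_def exponent powr_add using elim by simp
    then show ?case using elim by simp
  qed
  ultimately show ?thesis by (rule Lim_transform_eventually)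
qed

text \<open>
  The common shape of the upper and the lower bound for the quotient of consecutive terms, with \<open>h\<close> the
  part that differs. The powers of \<open>n\<close> cancel since \<open>block_scale a n powr (1 + a) = real n powr a\<close>; this
  is where the exponent of the scale comes from.
\<close>

lemma block_ratio_limit:
  assumes s: "s > 0" and h: "filterlim h (nhds (1 / a)) sequentially"
    and eq: "eventually (\<lambda>n. H n = y / (s * block_scale a n) * (real n / (s * block_scale a n) * h n) powr a) sequentially"
    and h_pos: "eventually (\<lambda>n. h n > 0) sequentially"
  shows "H \<longlonglongrightarrow> (block_const a y / s) powr (1 + a)"
proof -
  have "(\<lambda>n. y / s powr (1 + a) * h n powr a) \<longlonglongrightarrow> y / s powr (1 + a) * (1 / a) powr a"
    using a by (intro tendsto_intros h) auto
  moreover have "y / s powr (1 + a) * (1 / a) powr a = (block_const a y / s) powr (1 + a)"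
    using block_const_pos s a by (simp add: powr_divide block_const_powr)
  moreover have "eventually (\<lambda>n. y / s powr (1 + a) * h n powr a = H n) sequentially"
    using eq h_pos eventually_gt_at_top[of 0]
  proof eventually_elim
    case (elim n)
    define b where "b = block_scale a n"
    have b: "b > 0" using elim by (simp add: b_def block_scale_def)
    have "b * b powr a = b powr (1 + a)"
      using b by (simp add: powr_add)
    also have "\<dots> = real n powr a"
      using a by (simp add: b_def block_scale_def powr_powr)
    finally have n: "real n powr a = b * b powr a" by simp
    have "H n = y / (s * b) * (real n powr a / (s powr a * b powr a) * h n powr a)"
      using elim b s by (simp add: b_def[symmetric] powr_mult powr_divide)
    also have "\<dots> = y / (s * s powr a) * h n powr a"
      using b unfolding n by simp
    also have "s * s powr a = s powr (1 + a)" using s by (simp add: powr_add)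
    finally show ?case by simp
  qed
  ultimately show ?thesis by (auto intro: Lim_transform_eventually)
qed

lemma upper_ratio_limit:
  assumes s: "s > 0"
  shows "(\<lambda>n. y / (s * block_scale a n) * (1 + real n / (a * (s * block_scale a n) - 1)) powr a)
           \<longlonglongrightarrow> (block_const a y / s) powr (1 + a)"
proof -
  have inv: "(\<lambda>n. 1 / block_scale a n) \<longlonglongrightarrow> 0"
    using block_scale_at_top by (intro tendsto_divide_0[OF tendsto_const] filterlim_at_top_imp_at_infinity)
  let ?h = "\<lambda>n. s * (block_scale a n / real n) + s / (a * s - 1 / block_scale a n)"
  have h: "?h \<longlonglongrightarrow> s * 0 + s / (a * s - 0)"
    using a s by (intro tendsto_intros block_scale_over_n_tendsto_0 inv) auto
  then have h': "?h \<longlonglongrightarrow> 1 / a" using s by simp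
  have big: "eventually (\<lambda>n. block_scale a n > 1 / (a * s)) sequentially"
    using block_scale_at_top by (rule filterlim_at_top_dense[THEN iffD1, rule_format])
  show ?thesis
  proof (rule block_ratio_limit[OF s h'])
    show "eventually (\<lambda>n. ?h n > 0) sequentially"
      using h' by (rule order_tendstoD) (use a in simp)
    show "eventually (\<lambda>n. y / (s * block_scale a n) * (1 + real n / (a * (s * block_scale a n) - 1)) powr a =
        y / (s * block_scale a n) * (real n / (s * block_scale a n) * ?h n) powr a) sequentially"
      using big eventually_gt_at_top[of 0]
    proof eventually_elim
      case (elim n)
      define b where "b = block_scale a n"
      have "1 / (a * s) > 0" using a s by simp
      with elim have b: "b > 0" unfolding b_def by linarith
      have "a * s * b > 1" using elim a s by (simp add: b_def[symmetric] divide_less_eq mult_ac)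
      then have ne: "a * (s * b) - 1 \<noteq> 0" by (simp add: mult.assoc)
      have "s / (a * s - 1 / b) = s * b / (a * (s * b) - 1)"
        using b by (simp add: field_simps)
      then have "real n / (s * b) * (s * (b / real n) + s / (a * s - 1 / b)) = 1 + real n / (a * (s * b) - 1)"
        using b s elim ne by (simp add: distrib_left)
      then show ?case by (simp add: b_def)
    qed
  qed
qed

lemma lower_ratio_limit:
  assumes s: "s > 0"
  shows "(\<lambda>n. y / (s * block_scale a n) * (1 + real n / (a * (s * block_scale a n))) powr a)
           \<longlonglongrightarrow> (block_const a y / s) powr (1 + a)"
proof -
  let ?h = "\<lambda>n. s * (block_scale a n / real n) + 1 / a"
  have "?h \<longlonglongrightarrow> s * 0 + 1 / a"
    by (intro tendsto_intros block_scale_over_n_tendsto_0)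
  then have h': "?h \<longlonglongrightarrow> 1 / a" by simp
  show ?thesis
  proof (rule block_ratio_limit[OF s h'])
    show "eventually (\<lambda>n. ?h n > 0) sequentially"
      using h' by (rule order_tendstoD) (use a in simp)
    show "eventually (\<lambda>n. y / (s * block_scale a n) * (1 + real n / (a * (s * block_scale a n))) powr a =
        y / (s * block_scale a n) * (real n / (s * block_scale a n) * ?h n) powr a) sequentially"
      using eventually_gt_at_top[of 0]
    proof eventually_elim
      case (elim n)
      define b where "b = block_scale a n"
      have b: "b > 0" using elim by (simp add: b_def block_scale_def)
      have "real n / (s * b) * (s * (b / real n) + 1 / a) = 1 + real n / (a * (s * b))"
        using b s elim a by (simp add: distrib_left)
      then show ?case by (simp add: b_def)
    qed
  qed
qed

lemma tendsto_0_geometric: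
  fixes p :: "nat \<Rightarrow> real"
  assumes "0 < \<theta>" "\<theta> < 1" "\<And>n. p n \<ge> 0"
    and "\<And>d. eventually (\<lambda>n. p n \<le> C * \<theta> ^ d) sequentially"
  shows "p \<longlonglongrightarrow> 0"
proof (rule order_tendstoI)
  fix l :: real assume "l < 0"
  then show "eventually (\<lambda>n. p n > l) sequentially"
    using assms(3) by (intro always_eventually allI) (rule less_le_trans)
next
  fix u :: real assume u: "0 < u"
  have "(\<lambda>d. C * \<theta> ^ d) \<longlonglongrightarrow> C * 0"
    using assms by (intro tendsto_intros LIMSEQ_realpow_zero) auto
  then have "eventually (\<lambda>d. C * \<theta> ^ d < u) sequentially"
    using u by (intro order_tendstoD) auto
  then obtain d where "C * \<theta> ^ d < u" by (auto simp: eventually_sequentially)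
  with assms(4)[of d] show "eventually (\<lambda>n. p n < u) sequentially"
    by (auto elim: eventually_mono)
qed

text \<open>
  Above an intermediate level \<open>s1\<close> each step shrinks the terms by a factor \<open>\<theta> < 1\<close>. The distance
  between the levels \<open>s1\<close> and \<open>s\<close> eventually exceeds any number \<open>d\<close> of steps, and shifting the indices
  above \<open>s\<close> down by \<open>d\<close> shows that their share is at most \<open>\<theta> ^ d\<close>.
\<close>

lemma block_upper_tail:
  assumes law: "\<And>n. n \<ge> 1 \<Longrightarrow> gibbs_law (cpsm_weight (- a) (- y)) n (\<Omega> n) (M n)"
    and s: "s > block_const a y"
  shows "(\<lambda>n. measure (\<Omega> n) {\<omega> \<in> space (\<Omega> n). real (\<Sum>r=1..n. M n r \<omega>) > s * block_scale a n}) \<longlonglongrightarrow> 0"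
proof -
  define s1 where "s1 = (block_const a y + s) / 2"
  have s1: "block_const a y < s1" "s1 < s" "0 < s1"
    using s block_const_pos by (auto simp: s1_def)
  have "(block_const a y / s1) powr (1 + a) < 1 powr (1 + a)"
    using s1 block_const_pos a by (intro powr_less_mono2) auto
  then have "(block_const a y / s1) powr (1 + a) < 1" by simp
  then obtain \<theta> where th: "(block_const a y / s1) powr (1 + a) < \<theta>" "\<theta> < 1"
    using dense by blast
  have th0: "\<theta> > 0" using th(1) by (smt (verit) powr_ge_zero)
  have ratio: "eventually (\<lambda>n. y / (s1 * block_scale a n) * (1 + real n / (a * (s1 * block_scale a n) - 1)) powr a < \<theta>) sequentially"
    using upper_ratio_limit[OF s1(3)] th(1) by (rule order_tendstoD)
  have large: "eventually (\<lambda>n. block_scale a n > c) sequentially" for c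
    using block_scale_at_top by (rule filterlim_at_top_dense[THEN iffD1, rule_format])
  show ?thesis
  proof (rule tendsto_0_geometric[OF th0 th(2)])
    fix d
    show "eventually (\<lambda>n. measure (\<Omega> n) {\<omega> \<in> space (\<Omega> n). real (\<Sum>r=1..n. M n r \<omega>) > s * block_scale a n}
        \<le> exp y * \<theta> ^ d) sequentially"
      using ratio large[of "1 / (a * s1)"] large[of "real d / (s - s1)"] eventually_ge_at_top[of 1]
    proof eventually_elim
      case (elim n)
      define b where "b = block_scale a n"
      have b: "b > 0" using elim by (simp add: b_def block_scale_def)
      have ab: "1 < a * (s1 * b)"
        using elim(2) a s1 by (simp add: b_def[symmetric] divide_less_eq mult_ac)
      have db: "real d + s1 * b < s * b"
        using elim(3) s1 by (simp add: b_def[symmetric] divide_less_eq algebra_simps)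
      have step: "dobinski_term a y n (Suc k) \<le> \<theta> * dobinski_term a y n k" if "s1 * b \<le> real k" for k
      proof -
        have "dobinski_term a y n (Suc k) \<le> y / (s1 * b) * (1 + real n / (a * (s1 * b) - 1)) powr a * dobinski_term a y n k"
          using that ab b s1 by (intro dobinski_term_ratio_le) auto
        also have "\<dots> \<le> \<theta> * dobinski_term a y n k"
          using elim(1) by (intro mult_right_mono dobinski_term_nonneg) (simp add: b_def)
        finally show ?thesis .
      qed
      have steps: "dobinski_term a y n (k + m) \<le> \<theta> ^ m * dobinski_term a y n k" if "s1 * b \<le> real k" for k m
      proof (induction m)
        case (Suc m)
        have "dobinski_term a y n (k + Suc m) \<le> \<theta> * dobinski_term a y n (k + m)"
          using step[of "k + m"] that by simp
        also have "\<dots> \<le> \<theta> * (\<theta> ^ m * dobinski_term a y n k)"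
          using Suc th0 by (intro mult_left_mono) auto
        finally show ?case by (simp add: mult_ac)
      qed simp
      let ?F = "{k. k \<le> n \<and> s * b < real k}"
      have "d \<le> k" if "k \<in> ?F" for k
      proof -
        have "real d < real k" using that db b s1 by (smt (verit) mem_Collect_eq mult_pos_pos)
        then show ?thesis by simp
      qed
      note dk = this
      have "sum (dobinski_term a y n) ?F / suminf (dobinski_term a y n) \<le> \<theta> ^ d"
      proof (rule dobinski_sum_le_shifted[where \<sigma> = "\<lambda>k. k - d"])
        show "inj_on (\<lambda>k. k - d) ?F" by (rule inj_on_diff_nat) (rule dk)
        show "dobinski_term a y n k \<le> \<theta> ^ d * dobinski_term a y n (k - d)" if "k \<in> ?F" for k
          using steps[of "k - d" d] dk[OF that] that db by (simp add: of_nat_diff)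
      qed (use th0 in auto)
      then have "exp y * (sum (dobinski_term a y n) ?F / suminf (dobinski_term a y n)) \<le> exp y * \<theta> ^ d"
        by (intro mult_left_mono) auto
      then show ?case
        using gibbs_law_blocks_le_dobinski[OF law[OF elim(4)], of "\<lambda>k. s * b < real k"]
        by (simp add: b_def)
    qed
  qed simp
qed

text \<open>
  The mirror image of the upper tail: below \<open>s1\<close> each step up enlarges the terms by a factor \<open>q > 1\<close>,
  and indices are shifted up. The index 0 is separate because its term vanishes.
\<close>

lemma block_lower_tail:
  assumes law: "\<And>n. n \<ge> 1 \<Longrightarrow> gibbs_law (cpsm_weight (- a) (- y)) n (\<Omega> n) (M n)"
    and s: "s < block_const a y"
  shows "(\<lambda>n. measure (\<Omega> n) {\<omega> \<in> space (\<Omega> n). real (\<Sum>r=1..n. M n r \<omega>) \<le> s * block_scale a n}) \<longlonglongrightarrow> 0"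
proof -
  \<comment> \<open>the maximum keeps the intermediate level positive when \<open>s\<close> is not\<close>
  define s1 where "s1 = (block_const a y + max s 0) / 2"
  have s1: "s1 < block_const a y" "s < s1" "0 < s1"
    using s block_const_pos by (auto simp: s1_def max_def)
  have "1 powr (1 + a) < (block_const a y / s1) powr (1 + a)"
    using s1 block_const_pos a by (intro powr_less_mono2) auto
  then have "1 < (block_const a y / s1) powr (1 + a)" by simp
  then obtain q where q: "1 < q" "q < (block_const a y / s1) powr (1 + a)"
    using dense by blast
  define \<theta> where "\<theta> = 1 / q"
  have th: "0 < \<theta>" "\<theta> < 1" using q by (auto simp: \<theta>_def)
  have ratio: "eventually (\<lambda>n. q < y / (s1 * block_scale a n) * (1 + real n / (a * (s1 * block_scale a n))) powr a) sequentially"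
    using lower_ratio_limit[OF s1(3)] q(2) by (rule order_tendstoD)
  have large: "eventually (\<lambda>n. block_scale a n > c) sequentially" for c
    using block_scale_at_top by (rule filterlim_at_top_dense[THEN iffD1, rule_format])
  show ?thesis
  proof (rule tendsto_0_geometric[OF th])
    fix d
    show "eventually (\<lambda>n. measure (\<Omega> n) {\<omega> \<in> space (\<Omega> n). real (\<Sum>r=1..n. M n r \<omega>) \<le> s * block_scale a n}
        \<le> exp y * \<theta> ^ d) sequentially"
      using ratio large[of "real d / (s1 - s)"] eventually_ge_at_top[of 1]
    proof eventually_elim
      case (elim n)
      define b where "b = block_scale a n"
      have b: "b > 0" using elim by (simp add: b_def block_scale_def)
      have db: "s * b + real d < s1 * b"
        using elim(2) s1 by (simp add: b_def[symmetric] divide_less_eq algebra_simps)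
      have step: "dobinski_term a y n k \<le> \<theta> * dobinski_term a y n (Suc k)" if "real k + 1 \<le> s1 * b" for k
      proof (cases "k = 0")
        case True
        then show ?thesis using dobinski_term_0[OF elim(3)] th dobinski_term_nonneg by simp
      next
        case False
        have "q * dobinski_term a y n k \<le> y / (s1 * b) * (1 + real n / (a * (s1 * b))) powr a * dobinski_term a y n k"
          using elim(1) by (intro mult_right_mono dobinski_term_nonneg) (simp add: b_def)
        also have "\<dots> \<le> dobinski_term a y n (Suc k)"
          using that False by (intro dobinski_term_ratio_ge) auto
        finally show ?thesis using q by (simp add: \<theta>_def field_simps)
      qed
      have steps: "dobinski_term a y n k \<le> \<theta> ^ m * dobinski_term a y n (k + m)" if "real k + real m \<le> s1 * b" for k m
        using that
      proof (induction m)
        case (Suc m)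
        have "dobinski_term a y n k \<le> \<theta> ^ m * dobinski_term a y n (k + m)"
          using Suc by simp
        also have "\<dots> \<le> \<theta> ^ m * (\<theta> * dobinski_term a y n (Suc (k + m)))"
          using Suc.prems th by (intro mult_left_mono step) auto
        finally show ?case by (simp add: mult_ac)
      qed simp
      let ?F = "{k. k \<le> n \<and> real k \<le> s * b}"
      have "sum (dobinski_term a y n) ?F / suminf (dobinski_term a y n) \<le> \<theta> ^ d"
      proof (rule dobinski_sum_le_shifted[where \<sigma> = "\<lambda>k. k + d"])
        show "dobinski_term a y n k \<le> \<theta> ^ d * dobinski_term a y n (k + d)" if "k \<in> ?F" for k
          using that db by (intro steps) auto
      qed (use th in auto)
      then have "exp y * (sum (dobinski_term a y n) ?F / suminf (dobinski_term a y n)) \<le> exp y * \<theta> ^ d"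
        by (intro mult_left_mono) auto
      then show ?case
        using gibbs_law_blocks_le_dobinski[OF law[OF elim(3)], of "\<lambda>k. real k \<le> s * b"]
        by (simp add: b_def)
    qed
  qed simp
qed

end

lemma blocks_weak_limit_neg:
  assumes law: "\<And>n. n \<ge> 1 \<Longrightarrow> gibbs_law (cpsm_weight (- a) (- y)) n (\<Omega> n) (M n)"
    and a: "a > 0" and y: "y > 0"
  shows "weak_conv_m (\<lambda>n. distr (\<Omega> n) borel (\<lambda>\<omega>. real (\<Sum>r=1..n. M n r \<omega>) / real n powr (a / (1 + a))))
           (return borel ((a * y) powr (1 / (1 + a)) / a))"
proof (rule weak_conv_m_const)
  show "eventually (\<lambda>n. prob_space (\<Omega> n) \<and>
      (\<lambda>\<omega>. real (\<Sum>r=1..n. M n r \<omega>) / real n powr (a / (1 + a))) \<in> borel_measurable (\<Omega> n)) sequentially"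
    using eventually_ge_at_top[of 1]
  proof eventually_elim
    case (elim n)
    note meas = gibbs_law_measurable[OF law[OF elim]]
    have [measurable]: "(\<lambda>\<omega>. real (\<Sum>r=1..n. M n r \<omega>)) \<in> borel_measurable (\<Omega> n)"
      using measurable_compose[OF meas(3), of real borel] by simp
    show ?case by (intro conjI meas(1)) measurable
  qed
next
  fix s assume s: "s < (a * y) powr (1 / (1 + a)) / a"
  show "(\<lambda>n. measure (\<Omega> n) {\<omega> \<in> space (\<Omega> n).
      real (\<Sum>r=1..n. M n r \<omega>) / real n powr (a / (1 + a)) \<le> s}) \<longlonglongrightarrow> 0"
  proof (rule Lim_transform_eventually[OF block_lower_tail[OF a y law]])
    show "s < block_const a y" using s a y by (simp add: block_const_def)
    show "eventually (\<lambda>n. measure (\<Omega> n) {\<omega> \<in> space (\<Omega> n). real (\<Sum>r=1..n. M n r \<omega>) \<le> s * block_scale a n} =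
        measure (\<Omega> n) {\<omega> \<in> space (\<Omega> n). real (\<Sum>r=1..n. M n r \<omega>) / real n powr (a / (1 + a)) \<le> s}) sequentially"
      using eventually_gt_at_top[of 0]
      by eventually_elim (simp add: block_scale_def divide_le_eq)
  qed
next
  fix s assume s: "s > (a * y) powr (1 / (1 + a)) / a"
  show "(\<lambda>n. measure (\<Omega> n) {\<omega> \<in> space (\<Omega> n).
      s < real (\<Sum>r=1..n. M n r \<omega>) / real n powr (a / (1 + a))}) \<longlonglongrightarrow> 0"
  proof (rule Lim_transform_eventually[OF block_upper_tail[OF a y law]])
    show "s > block_const a y" using s a y by (simp add: block_const_def)
    show "eventually (\<lambda>n. measure (\<Omega> n) {\<omega> \<in> space (\<Omega> n). s * block_scale a n < real (\<Sum>r=1..n. M n r \<omega>)} =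
        measure (\<Omega> n) {\<omega> \<in> space (\<Omega> n). s < real (\<Sum>r=1..n. M n r \<omega>) / real n powr (a / (1 + a))}) sequentially"
      using eventually_gt_at_top[of 0]
      by eventually_elim (simp add: block_scale_def less_divide_eq)
  qed
qed

section \<open>The limit theorem\<close>

theorem theorem1:
  fixes \<alpha> z :: real
    and \<Omega> :: "nat \<Rightarrow> 'a measure"
    and M :: "nat \<Rightarrow> nat \<Rightarrow> 'a \<Rightarrow> nat"
  assumes "\<And>n. n \<ge> 1 \<Longrightarrow> nb_cpsm \<alpha> z n (\<Omega> n) (M n)"
  shows
    "(0 < \<alpha> \<and> \<alpha> < 1 \<and> z > 0 \<longrightarrow>
        weak_conv_m
          (\<lambda>n. distr (\<Omega> n) borel (\<lambda>\<omega>. real (\<Sum>r=1..n. M n r \<omega>)))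
          (distr (measure_pmf (poisson_pmf z)) borel (\<lambda>k. 1 + real k)) \<and>
        (\<forall>r\<ge>1. weak_conv_m
          (\<lambda>n. distr (\<Omega> n) borel (\<lambda>\<omega>. real (M n r \<omega>)))
          (distr (measure_pmf (poisson_pmf (\<alpha> * pochhammer (1 - \<alpha>) (r - 1) / fact r * z)))
             borel real))) \<and>
     (\<alpha> < 0 \<and> z < 0 \<longrightarrow>
        weak_conv_m
          (\<lambda>n. distr (\<Omega> n) borel
             (\<lambda>\<omega>. real (\<Sum>r=1..n. M n r \<omega>) / real n powr (- \<alpha> / (1 - \<alpha>))))
          (return borel ((\<alpha> * z) powr (1 / (1 - \<alpha>)) / (- \<alpha>))) \<and>
        (\<forall>r\<ge>1. weak_conv_m
          (\<lambda>n. distr (\<Omega> n) borel (\<lambda>\<omega>. real (M n r \<omega>)))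
          (distr (measure_pmf (poisson_pmf (\<alpha> * pochhammer (1 - \<alpha>) (r - 1) / fact r * z)))
             borel real)))"
proof -
  have law: "gibbs_law (cpsm_weight \<alpha> z) n (\<Omega> n) (M n)" if "n \<ge> 1" for n
    using assms[OF that] by (rule nb_cpsm_gibbs_law)
  have rate: "\<alpha> * pochhammer (1 - \<alpha>) (r - 1) / fact r * z = cpsm_weight \<alpha> z r" for r
    by (simp add: cpsm_weight_def)
  have mult: "weak_conv_m (\<lambda>n. distr (\<Omega> n) borel (\<lambda>\<omega>. real (M n r \<omega>)))
      (distr (measure_pmf (poisson_pmf (\<alpha> * pochhammer (1 - \<alpha>) (r - 1) / fact r * z))) borel real)"
    if "\<alpha> < 1" "\<alpha> * z > 0" "r \<ge> 1"
      "(\<lambda>n. gibbs_sum (cpsm_weight \<alpha> z) n / gibbs_sum (cpsm_weight \<alpha> z) (Suc n)) \<longlonglongrightarrow> 1" for r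
    unfolding rate using that
    by (intro gibbs_multiplicity_weak_limit law cpsm_weight_pos) auto
  have pos: "weak_conv_m (\<lambda>n. distr (\<Omega> n) borel (\<lambda>\<omega>. real (\<Sum>r=1..n. M n r \<omega>)))
      (distr (measure_pmf (poisson_pmf z)) borel (\<lambda>k. 1 + real k))"
    if "0 < \<alpha>" "\<alpha> < 1" "z > 0"
    by (rule blocks_weak_limit_pos[OF law that])
  have neg: "weak_conv_m (\<lambda>n. distr (\<Omega> n) borel
        (\<lambda>\<omega>. real (\<Sum>r=1..n. M n r \<omega>) / real n powr (- \<alpha> / (1 - \<alpha>))))
      (return borel ((\<alpha> * z) powr (1 / (1 - \<alpha>)) / (- \<alpha>)))"
    if "\<alpha> < 0" "z < 0"
    using blocks_weak_limit_neg[of "- \<alpha>" "- z" \<Omega> M] law that by simp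
  show ?thesis
    using pos neg mult gibbs_sum_cpsm_ratio_tendsto_1_pos gibbs_sum_cpsm_ratio_tendsto_1_neg[of "- \<alpha>" "- z"]
    by (auto simp: mult_neg_neg simp del: of_nat_sum)
qed

end
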